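(* For a pair $(X,A)$, the following are equivalent: (1) $(X,A)$ has strong computable type; (2) for every copy $(Y,B)$ of $(X,A)$ in $Q$, there exists a property of pairs $\mathcal P$ which is $\Pi^0_1$ in the product of upper Vietoris topologies on $\mathcal K(Q)^2$ and such that $(Y,B)$ is $\mathcal P$-minimal.
   Context: $Q=[0,1]^{\mathbb N}$ is the Hilbert cube with metric $d_Q(x,y)=\sum_i2^{-i}|x_i-y_i|$ and rational open balls centered at rational points with finitely many nonzero coordinates. A pair $(X,A)$ is a compact metrizable space $X$ with compact $A\subseteq X$; a copy of it in $Q$ is $(Y,B)$ with $Y\subseteq Q$ and a homeomorphism $X\to Y$ sending $A$ onto $B$. A compact $K\subseteq Q$ is semicomputable relative to an oracle $O$ if the set of finite lists of rational balls whose union contains $K$ is c.e. relative to $O$; it is computable relative to $O$ if moreover the set of rational balls meeting $K$ is c.e. relative to $O$. $(X,A)$ has strong computable type if for every oracle $O$ and every copy $(Y,B)$ in $Q$ with $Y,B$ semicomputable relative to $O$, $Y$ is computable relative to $O$. $\mathcal K(Q)$ is the set of compact subsets of $Q$; its upper Vietoris topology has basis $\{K:K\subseteq U\}$ for $U$ ranging over finite unions of rational balls (effectively numbered); a set is $\Pi^0_1$ if its complement is a union of a c.e. family of basic open sets (in the product topology on $\mathcal K(Q)^2$, basic open sets are products of basic open sets). A property of pairs is a subset $\mathcal P\subseteq\mathcal K(Q)^2$. A pair $(X',A')$ is a proper subpair of $(X,A)$ if $X'\subsetneq X$ and $A'\subseteq A$. A pair $(X,A)$ in $Q$ is $\mathcal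 P$-minimal if $(X,A)\in\mathcal P$ and no proper subpair of $(X,A)$ is in $\mathcal P$. *)

theory Defs
  imports "HOL-Analysis.Analysis" "HOL-Library.Nat_Bijection"
begin

datatype recf =
    Zero
  | Succ
  | Proj nat
  | Oracle
  | Comp recf "recf list"
  | PrimRec recf recf
  | Mu recf

text \<open>
  \<open>eval orc f xs y\<close> says that the partial function denoted by \<open>f\<close>, with the characteristic
  function of \<open>orc\<close> as an additional basic function, converges on \<open>xs\<close> with value \<open>y\<close>.
  Arities are not part of the syntax: \<open>Succ\<close> and \<open>Oracle\<close> look at the first argument only and,
  like \<open>Proj\<close>, diverge if the argument is missing.
\<close>

inductive eval :: "nat set \<Rightarrow> recf \<Rightarrow> nat list \<Rightarrow> nat \<Rightarrow> bool" for orc where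
  zero: "eval orc Zero xs 0"
| succ: "eval orc Succ (x # xs) (Suc x)"
| proj: "i < length xs \<Longrightarrow> eval orc (Proj i) xs (xs ! i)"
| query: "eval orc Oracle (x # xs) (if x \<in> orc then 1 else 0)"
| comp: "list_all2 (\<lambda>g y. eval orc g xs y) gs ys \<Longrightarrow> eval orc f ys z
    \<Longrightarrow> eval orc (Comp f gs) xs z"
| primrec_0: "eval orc f xs y \<Longrightarrow> eval orc (PrimRec f g) (0 # xs) y"
| primrec_Suc: "eval orc (PrimRec f g) (n # xs) y \<Longrightarrow> eval orc g (n # y # xs) z
    \<Longrightarrow> eval orc (PrimRec f g) (Suc n # xs) z"
| mu: "eval orc f (n # xs) 0 \<Longrightarrow> (\<forall>m<n. \<exists>y>0. eval orc f (m # xs) y)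
    \<Longrightarrow> eval orc (Mu f) xs n"

definition ce_rel :: "nat set \<Rightarrow> nat set \<Rightarrow> bool" where
  "ce_rel orc S \<longleftrightarrow> (\<exists>f. S = {n. \<exists>y. eval orc f [n] y})"

text \<open>The empty set as \<open>orc\<close> gives plain computability.\<close>

definition ce :: "nat set \<Rightarrow> bool" where
  "ce S \<longleftrightarrow> ce_rel {} S"

typedef hilbert_cube = "{x :: nat \<Rightarrow> real. \<forall>i. x i \<in> {0..1}}"
  morphisms coord Hcube
  by (rule exI[of _ "\<lambda>_. 0"]) simp

lemma coord_bounds: "0 \<le> coord x i" "coord x i \<le> 1"
  using coord[of x] by auto

lemma summable_hilbert_cube:
  "summable (\<lambda>i. (1/2)^i * \<bar>coord x i - coord y i\<bar>)"
proof (rule summable_comparison_test)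
  have "\<bar>coord x i - coord y i\<bar> \<le> 1" for i
    using coord_bounds[of x i] coord_bounds[of y i] by linarith
  then show "\<exists>N. \<forall>n\<ge>N. norm ((1/2)^n * \<bar>coord x n - coord y n\<bar>) \<le> (1/2)^n"
    by (auto simp: abs_mult mult_left_le)
qed (simp add: summable_geometric)

instantiation hilbert_cube :: metric_space
begin

definition dist_hilbert_cube :: "hilbert_cube \<Rightarrow> hilbert_cube \<Rightarrow> real" where
  "dist_hilbert_cube x y = (\<Sum>i. (1/2)^i * \<bar>coord x i - coord y i\<bar>)"

definition uniformity_hilbert_cube :: "(hilbert_cube \<times> hilbert_cube) filter" where
  "uniformity_hilbert_cube = (INF e\<in>{0<..}. principal {(x, y). dist x y < e})"

definition open_hilbert_cube :: "hilbert_cube set \<Rightarrow> bool" where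
  "open_hilbert_cube U \<longleftrightarrow>
    (\<forall>x\<in>U. eventually (\<lambda>(x', y). x' = x \<longrightarrow> y \<in> U) uniformity)"

instance
proof
  fix x y z :: hilbert_cube
  have "dist x y = 0 \<longleftrightarrow> (\<forall>i. (1/2::real)^i * \<bar>coord x i - coord y i\<bar> = 0)"
    unfolding dist_hilbert_cube_def
    by (rule suminf_eq_zero_iff[OF summable_hilbert_cube]) simp
  also have "\<dots> \<longleftrightarrow> coord x = coord y"
    by auto
  finally show "dist x y = 0 \<longleftrightarrow> x = y"
    by (simp add: coord_inject)
  have "dist x y \<le> (\<Sum>i. (1/2)^i * \<bar>coord x i - coord z i\<bar> + (1/2)^i * \<bar>coord y i - coord z i\<bar>)"
    unfolding dist_hilbert_cube_def
  proof (intro suminf_le summable_add summable_hilbert_cube)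
    fix i
    have "\<bar>coord x i - coord y i\<bar> \<le> \<bar>coord x i - coord z i\<bar> + \<bar>coord y i - coord z i\<bar>"
      by linarith
    then have "(1/2)^i * \<bar>coord x i - coord y i\<bar>
        \<le> (1/2)^i * (\<bar>coord x i - coord z i\<bar> + \<bar>coord y i - coord z i\<bar>)"
      by (intro mult_left_mono) auto
    then show "(1/2)^i * \<bar>coord x i - coord y i\<bar>
        \<le> (1/2)^i * \<bar>coord x i - coord z i\<bar> + (1/2)^i * \<bar>coord y i - coord z i\<bar>"
      by (simp only: distrib_left)
  qed
  also have "\<dots> = dist x z + dist y z"
    unfolding dist_hilbert_cube_def
    by (rule suminf_add[symmetric]) (rule summable_hilbert_cube)+
  finally show "dist x y \<le> dist x z + dist y z" .
qed (simp_all add: uniformity_hilbert_cube_def open_hilbert_cube_def)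

end

definition unit_rat :: "nat \<Rightarrow> real" where
  "unit_rat n = (case prod_decode n of (a, b) \<Rightarrow> min 1 (real a / real (Suc b)))"

definition pos_rat :: "nat \<Rightarrow> real" where
  "pos_rat n = (case prod_decode n of (a, b) \<Rightarrow> real (Suc a) / real (Suc b))"

definition rat_point :: "nat \<Rightarrow> hilbert_cube" where
  "rat_point n = Hcube (\<lambda>i. let l = list_decode n in
     if i < length l then unit_rat (l ! i) else 0)"

definition rat_ball :: "nat \<Rightarrow> hilbert_cube set" where
  "rat_ball n = (case prod_decode n of (c, r) \<Rightarrow> ball (rat_point c) (pos_rat r))"

definition rat_ball_union :: "nat \<Rightarrow> hilbert_cube set" where
  "rat_ball_union n = (\<Union>i\<in>set (list_decode n). rat_ball i)"

lemma range_unit_rat: "range unit_rat = \<rat> \<inter> {0..1}"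
proof
  show "range unit_rat \<subseteq> \<rat> \<inter> {0..1}"
    by (auto simp: unit_rat_def min_def split: prod.splits)
  show "\<rat> \<inter> {0..1} \<subseteq> range unit_rat"
  proof
    fix q :: real assume q: "q \<in> \<rat> \<inter> {0..1}"
    then obtain a b where ab: "b \<noteq> 0" "\<bar>q\<bar> = real a / real b"
      by (meson IntD1 Rats_abs_nat_div_natE)
    then have "unit_rat (prod_encode (a, b - 1)) = q"
      using q by (simp add: unit_rat_def)
    then show "q \<in> range unit_rat" by (rule range_eqI[OF sym])
  qed
qed

lemma range_pos_rat: "range pos_rat = \<rat> \<inter> {0<..}"
proof
  show "range pos_rat \<subseteq> \<rat> \<inter> {0<..}"
    by (auto simp: pos_rat_def simp del: of_nat_Suc split: prod.splits)
  show "\<rat> \<inter> {0<..} \<subseteq> range pos_rat"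
  proof
    fix q :: real assume q: "q \<in> \<rat> \<inter> {0<..}"
    then obtain a b where ab: "b \<noteq> 0" "\<bar>q\<bar> = real a / real b"
      by (meson IntD1 Rats_abs_nat_div_natE)
    then have "a \<noteq> 0" using q by (cases "a = 0") auto
    with ab have "pos_rat (prod_encode (a - 1, b - 1)) = q"
      using q by (simp add: pos_rat_def)
    then show "q \<in> range pos_rat" by (rule range_eqI[OF sym])
  qed
qed

lemma coord_rat_point:
  "coord (rat_point n) i =
    (if i < length (list_decode n) then unit_rat (list_decode n ! i) else 0)"
proof -
  have "unit_rat k \<in> {0..1}" for k
    using range_unit_rat by blast
  then show ?thesis
    by (simp add: rat_point_def Let_def Hcube_inverse)
qed

lemma range_rat_point:
  "range rat_point = {x. (\<forall>i. coord x i \<in> \<rat>) \<and> finite {i. coord x i \<noteq> 0}}"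
proof (intro equalityI subsetI)
  fix x assume "x \<in> range rat_point"
  then obtain n where x: "x = rat_point n" by auto
  have "{i. coord x i \<noteq> 0} \<subseteq> {..<length (list_decode n)}"
    by (auto simp: x coord_rat_point)
  moreover have "unit_rat k \<in> \<rat>" for k
    using range_unit_rat by blast
  ultimately show "x \<in> {x. (\<forall>i. coord x i \<in> \<rat>) \<and> finite {i. coord x i \<noteq> 0}}"
    using finite_subset by (auto simp: x coord_rat_point)
next
  fix x assume "x \<in> {x. (\<forall>i. coord x i \<in> \<rat>) \<and> finite {i. coord x i \<noteq> 0}}"
  then have r: "\<And>i. coord x i \<in> \<rat> \<inter> {0..1}" and f: "finite {i. coord x i \<noteq> 0}"
    using coord_bounds by auto
  obtain m where m: "\<And>i. coord x i \<noteq> 0 \<Longrightarrow> i < m"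
    using f unfolding finite_nat_set_iff_bounded by auto
  have "\<exists>n. unit_rat n = coord x i" for i
  proof -
    have "coord x i \<in> range unit_rat"
      using r[of i] by (simp only: range_unit_rat)
    then show ?thesis by (metis rangeE)
  qed
  then obtain k where k: "\<And>i. unit_rat (k i) = coord x i"
    by metis
  have "coord (rat_point (list_encode (map k [0..<m]))) = coord x"
    using m by (auto simp: coord_rat_point k fun_eq_iff)
  then show "x \<in> range rat_point"
    by (metis coord_inject rangeI)
qed

lemma range_rat_ball:
  "range rat_ball = {ball c r | c r. (\<forall>i. coord c i \<in> \<rat>) \<and> finite {i. coord c i \<noteq> 0}
     \<and> r \<in> \<rat> \<and> 0 < r}"
proof -
  have "range rat_ball = {ball c r | c r. c \<in> range rat_point \<and> r \<in> range pos_rat}"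
  proof (intro equalityI subsetI)
    fix b assume "b \<in> range rat_ball"
    then show "b \<in> {ball c r | c r. c \<in> range rat_point \<and> r \<in> range pos_rat}"
      by (fastforce simp: rat_ball_def split: prod.splits)
  next
    fix b assume "b \<in> {ball c r | c r. c \<in> range rat_point \<and> r \<in> range pos_rat}"
    then obtain n m where "b = ball (rat_point n) (pos_rat m)" by auto
    then have "b = rat_ball (prod_encode (n, m))" by (simp add: rat_ball_def)
    then show "b \<in> range rat_ball" by simp
  qed
  then show ?thesis
    by (auto simp: range_rat_point range_pos_rat)
qed

definition semicomputable :: "nat set \<Rightarrow> hilbert_cube set \<Rightarrow> bool" where
  "semicomputable orc K \<longleftrightarrow> compact K \<and> ce_rel orc {n. K \<subseteq> rat_ball_union n}"

definition computable :: "nat set \<Rightarrow> hilbert_cube set \<Rightarrow> bool" where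
  "computable orc K \<longleftrightarrow> semicomputable orc K \<and> ce_rel orc {n. rat_ball n \<inter> K \<noteq> {}}"

definition compact_pair :: "'a topology \<Rightarrow> 'a set \<Rightarrow> bool" where
  "compact_pair X A \<longleftrightarrow> compact_space X \<and> metrizable_space X \<and> compactin X A"

definition is_copy ::
  "'a topology \<Rightarrow> 'a set \<Rightarrow> hilbert_cube set \<Rightarrow> hilbert_cube set \<Rightarrow> bool" where
  "is_copy X A Y B \<longleftrightarrow> (\<exists>h. homeomorphic_map X (top_of_set Y) h \<and> h ` A = B)"

definition strong_computable_type :: "'a topology \<Rightarrow> 'a set \<Rightarrow> bool" where
  "strong_computable_type X A \<longleftrightarrow>
    (\<forall>orc Y B. is_copy X A Y B \<and> semicomputable orc Y \<and> semicomputable orc B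
      \<longrightarrow> computable orc Y)"

definition compacts :: "hilbert_cube set set" where
  "compacts = {K. compact K}"

definition upper_basic :: "nat \<Rightarrow> hilbert_cube set set" where
  "upper_basic n = {K \<in> compacts. K \<subseteq> rat_ball_union n}"

definition upper_basic2 :: "nat \<Rightarrow> (hilbert_cube set \<times> hilbert_cube set) set" where
  "upper_basic2 n = (case prod_decode n of (a, b) \<Rightarrow> upper_basic a \<times> upper_basic b)"

definition Pi01 :: "(hilbert_cube set \<times> hilbert_cube set) set \<Rightarrow> bool" where
  "Pi01 P \<longleftrightarrow> P \<subseteq> compacts \<times> compacts \<and>
    (\<exists>W. ce W \<and> (compacts \<times> compacts) - P = (\<Union>n\<in>W. upper_basic2 n))"

definition pair_in_cube :: "hilbert_cube set \<Rightarrow> hilbert_cube set \<Rightarrow> bool" where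
  "pair_in_cube X A \<longleftrightarrow> compact X \<and> compact A \<and> A \<subseteq> X"

text \<open>A property may contain elements \<open>(K, L)\<close> with \<open>\<not> L \<subseteq> K\<close>; these are not pairs and do not
  count as subpairs.\<close>

definition proper_subpair ::
  "hilbert_cube set \<Rightarrow> hilbert_cube set \<Rightarrow> hilbert_cube set \<Rightarrow> hilbert_cube set \<Rightarrow> bool" where
  "proper_subpair X' A' X A \<longleftrightarrow> pair_in_cube X' A' \<and> X' \<subset> X \<and> A' \<subseteq> A"

definition minimal_pair ::
  "(hilbert_cube set \<times> hilbert_cube set) set \<Rightarrow> hilbert_cube set \<Rightarrow> hilbert_cube set \<Rightarrow> bool" where
  "minimal_pair P X A \<longleftrightarrow> pair_in_cube X A \<and> (X, A) \<in> P \<and>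
    (\<forall>X' A'. proper_subpair X' A' X A \<longrightarrow> (X', A') \<notin> P)"

end

theory Submission imports Defs begin

text \<open>
  If \<open>(Y, B)\<close> is \<open>P\<close>-minimal, then a ball \<open>D\<close> meets \<open>Y\<close> iff \<open>(Y - D, B - D)\<close> is not in \<open>P\<close>, and
  \<open>Y - D \<subseteq> U\<close> iff \<open>Y \<subseteq> U \<union> D\<close>; this makes the balls meeting \<open>Y\<close> c.e. in any oracle in which
  \<open>Y\<close> and \<open>B\<close> are semicomputable.

  Conversely, let \<open>V\<close> be the set of codes of basic neighbourhoods of \<open>(Y, B)\<close>. In every
  enumeration of \<open>V\<close> both sets are semicomputable, so the set of balls meeting \<open>Y\<close> is c.e. in every
  enumeration of \<open>V\<close>, hence enumeration reducible to \<open>V\<close> (Selman): there is a c.e. family of pairs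
  \<open>(d, F)\<close>, \<open>F\<close> a finite set of neighbourhoods, such that ball \<open>d\<close> meets \<open>Y\<close> iff some \<open>(d, F)\<close> in the
  family satisfies \<open>F \<subseteq> V\<close>. The complement of \<open>P\<close> consists of the \<open>(K, L)\<close> that lie in all members of
  \<open>F\<close> while \<open>K\<close> misses the closed ball \<open>d\<close>, for some \<open>(d, F)\<close> in the family. A proper subpair
  inherits all neighbourhoods of \<open>(Y, B)\<close> but misses some closed ball whose interior meets \<open>Y\<close>.
\<close>

section \<open>Total recursive functionals\<close>

text \<open>Functionals take the oracle as their first argument; a single program has to work for all
  oracles. Further numerical arguments are passed through the pairing function.\<close>

definition rec_fun :: "(nat set \<Rightarrow> nat \<Rightarrow> nat) \<Rightarrow> bool" where
  "rec_fun f \<longleftrightarrow> (\<exists>g. \<forall>orc x. eval orc g [x] (f orc x))"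

definition rec_pred :: "(nat set \<Rightarrow> nat \<Rightarrow> bool) \<Rightarrow> bool" where
  "rec_pred P \<longleftrightarrow> rec_fun (\<lambda>orc x. of_bool (P orc x))"

abbreviation pfst :: "nat \<Rightarrow> nat" where "pfst n \<equiv> fst (prod_decode n)"
abbreviation psnd :: "nat \<Rightarrow> nat" where "psnd n \<equiv> snd (prod_decode n)"

named_theorems rec_intros

section \<open>Programs for arithmetic and pairing\<close>

lemma eval_PrimRec:
  assumes "eval orc f xs (h 0)" "\<And>i. eval orc g (i # h i # xs) (h (Suc i))"
  shows "eval orc (PrimRec f g) (n # xs) (h n)"
proof (induction n)
  case 0
  then show ?case by (rule eval.primrec_0) (rule assms(1))
next
  case (Suc n)
  then show ?case by (rule eval.primrec_Suc) (rule assms(2))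
qed

lemma eval_Comp1: "eval orc g xs y \<Longrightarrow> eval orc f [y] z \<Longrightarrow> eval orc (Comp f [g]) xs z"
  by (rule eval.comp[of _ _ _ "[y]"]) auto

lemma eval_Comp2: "eval orc g xs y \<Longrightarrow> eval orc g' xs y' \<Longrightarrow> eval orc f [y, y'] z
    \<Longrightarrow> eval orc (Comp f [g, g']) xs z"
  by (rule eval.comp[of _ _ _ "[y, y']"]) auto

lemma eval_Proj: "i < length xs \<Longrightarrow> xs ! i = y \<Longrightarrow> eval orc (Proj i) xs y"
  using eval.proj by blast

definition "recf_one = Comp Succ [Zero]"
definition "recf_add = PrimRec (Proj 0) (Comp Succ [Proj 1])"
definition "recf_pred = PrimRec Zero (Proj 0)"
text \<open>\<open>PrimRec\<close> recurses on its first argument, but subtraction recurses on the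
  subtrahend; the outer \<open>Comp\<close> swaps the two arguments.\<close>

definition "recf_sub = Comp (PrimRec (Proj 0) (Comp recf_pred [Proj 1])) [Proj 1, Proj 0]"
definition "recf_mult = PrimRec Zero (Comp recf_add [Proj 1, Proj 2])"
definition "recf_triangle = PrimRec Zero (Comp recf_add [Comp Succ [Proj 0], Proj 1])"
text \<open>Cantor's pairing \<open>triangle (m + n) + m\<close>.\<close>

definition "recf_pair = Comp recf_add [Comp recf_triangle [recf_add], Proj 0]"

lemma eval_one: "eval orc recf_one xs 1"
  unfolding recf_one_def One_nat_def by (rule eval_Comp1) (rule eval.zero eval.succ)+

lemma eval_add: "eval orc recf_add [m, n] (m + n)"
  unfolding recf_add_def
proof (rule eval_PrimRec[where h = "\<lambda>m. m + n"])
  show "eval orc (Comp Succ [Proj 1]) [i, i + n, n] (Suc i + n)" for i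
    by (rule eval_Comp1[where y = "i + n"]) (auto intro: eval_Proj eval.succ)
qed (auto intro: eval_Proj)

lemma eval_pred: "eval orc recf_pred [n] (n - 1)"
  unfolding recf_pred_def
  by (rule eval_PrimRec[where h = "\<lambda>n. n - 1"]) (auto intro: eval_Proj eval.zero)

lemma eval_sub: "eval orc recf_sub [m, n] (m - n)"
  unfolding recf_sub_def
proof (rule eval_Comp2)
  show "eval orc (PrimRec (Proj 0) (Comp recf_pred [Proj 1])) [n, m] (m - n)"
  proof (rule eval_PrimRec[where h = "\<lambda>n. m - n"])
    show "eval orc (Comp recf_pred [Proj 1]) [i, m - i, m] (m - Suc i)" for i
      using eval_pred[of orc "m - i"] by (intro eval_Comp1[where y = "m - i"]) (auto intro: eval_Proj)
  qed (auto intro: eval_Proj)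
qed (auto intro: eval_Proj)

lemma eval_mult: "eval orc recf_mult [m, n] (m * n)"
  unfolding recf_mult_def
proof (rule eval_PrimRec[where h = "\<lambda>m. m * n"])
  show "eval orc (Comp recf_add [Proj 1, Proj 2]) [i, i * n, n] (Suc i * n)" for i
    using eval_add[of orc "i * n" n]
    by (intro eval_Comp2[where y = "i * n" and y' = n]) (auto intro: eval_Proj simp: add.commute)
qed (auto intro: eval.zero)

lemma eval_triangle: "eval orc recf_triangle [n] (triangle n)"
  unfolding recf_triangle_def
proof (rule eval_PrimRec[where h = triangle])
  show "eval orc (Comp recf_add [Comp Succ [Proj 0], Proj 1]) [i, triangle i] (triangle (Suc i))" for i
    using eval_add[of orc "Suc i" "triangle i"]
    by (intro eval_Comp2[where y = "Suc i" and y' = "triangle i"] eval_Comp1[where y = i])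
      (auto intro: eval_Proj eval.succ simp: add.commute)
qed (auto intro: eval.zero)

lemma eval_pair: "eval orc recf_pair [m, n] (prod_encode (m, n))"
  unfolding recf_pair_def prod_encode_def prod.case
  by (rule eval_Comp2[OF eval_Comp1[OF eval_add eval_triangle] _ eval_add]) (auto intro: eval_Proj)

lemma rec_fun_id [rec_intros]: "rec_fun (\<lambda>orc x. x)"
  unfolding rec_fun_def by (rule exI[of _ "Proj 0"]) (auto intro: eval_Proj)

lemma rec_fun_compose:
  assumes "rec_fun f" "rec_fun g" shows "rec_fun (\<lambda>orc x. f orc (g orc x))"
  using assms unfolding rec_fun_def by (meson eval_Comp1)

lemma rec_fun_binary:
  assumes "\<And>orc m n. eval orc h [m, n] (F m n)" "rec_fun f" "rec_fun g"
  shows "rec_fun (\<lambda>orc x. F (f orc x) (g orc x))"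
  using assms unfolding rec_fun_def by (meson eval_Comp2)

lemmas rec_fun_add [rec_intros] = rec_fun_binary[OF eval_add]
lemmas rec_fun_diff [rec_intros] = rec_fun_binary[OF eval_sub]
lemmas rec_fun_mult [rec_intros] = rec_fun_binary[OF eval_mult]
lemmas rec_fun_pair [rec_intros] = rec_fun_binary[OF eval_pair]

lemma rec_fun_Suc [rec_intros]: "rec_fun f \<Longrightarrow> rec_fun (\<lambda>orc x. Suc (f orc x))"
  unfolding rec_fun_def by (meson eval_Comp1 eval.succ)

lemma rec_fun_const [rec_intros]: "rec_fun (\<lambda>orc x. c)"
proof (induction c)
  case 0
  then show ?case unfolding rec_fun_def using eval.zero by blast
qed (rule rec_fun_Suc)

lemma rec_fun_triangle [rec_intros]: "rec_fun f \<Longrightarrow> rec_fun (\<lambda>orc x. triangle (f orc x))"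
  unfolding rec_fun_def by (meson eval_Comp1 eval_triangle)

text \<open>The largest \<open>r\<close> with \<open>triangle r\<close> at most the argument. The
  truncated difference is 1 exactly when \<open>Suc k\<close> has reached the next triangular
  number, which turns the search for \<open>r\<close> into a primitive recursion.\<close>

fun triangle_root :: "nat \<Rightarrow> nat" where
  "triangle_root 0 = 0"
| "triangle_root (Suc k) =
    triangle_root k + (1 - (triangle (Suc (triangle_root k)) - Suc k))"

lemma triangle_root_bounds:
  "triangle (triangle_root k) \<le> k \<and> k < triangle (Suc (triangle_root k))"
proof (induction k)
  case (Suc k)
  then show ?case
    by (cases "Suc k < triangle (Suc (triangle_root k))") auto
qed auto

text \<open>As \<open>prod_encode (m, n)\<close> is \<open>triangle (m + n) + m\<close>, the
  triangular root recovers \<open>m + n\<close>, and both components follow by subtraction.\<close>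

lemma prod_decode_eq:
  "prod_decode k = (k - triangle (triangle_root k),
    triangle_root k - (k - triangle (triangle_root k)))"
proof -
  have "prod_encode (k - triangle (triangle_root k),
      triangle_root k - (k - triangle (triangle_root k))) = k"
    using triangle_root_bounds[of k] by (auto simp: prod_encode_def)
  then show ?thesis by (metis prod_encode_inverse)
qed

lemma rec_fun_triangle_root: "rec_fun (\<lambda>orc. triangle_root)"
proof -
  let ?g = "Comp recf_add [Proj 1, Comp recf_sub [recf_one,
     Comp recf_sub [Comp recf_triangle [Comp Succ [Proj 1]], Comp Succ [Proj 0]]]]"
  have "eval orc (PrimRec Zero ?g) [n] (triangle_root n)" for orc n
  proof (rule eval_PrimRec[where h = triangle_root])
    fix i
    have "eval orc (Comp Succ [Proj 0]) [i, triangle_root i] (Suc i)"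
      and "eval orc (Comp Succ [Proj 1]) [i, triangle_root i] (Suc (triangle_root i))"
      by (rule eval_Comp1[OF _ eval.succ], rule eval_Proj, simp, simp)+
    then show "eval orc ?g [i, triangle_root i] (triangle_root (Suc i))"
      unfolding triangle_root.simps
      by (intro eval_Comp2[OF _ _ eval_add] eval_Comp2[OF _ _ eval_sub]
          eval_Comp1[OF _ eval_triangle] eval_Proj eval_one) auto
  qed (auto intro: eval.zero)
  then show ?thesis unfolding rec_fun_def by blast
qed

lemma rec_fun_prod_decode [rec_intros]:
  assumes "rec_fun f"
  shows "rec_fun (\<lambda>orc x. pfst (f orc x))" "rec_fun (\<lambda>orc x. psnd (f orc x))"
  unfolding prod_decode_eq fst_conv snd_conv
  by (intro rec_intros assms rec_fun_compose[OF rec_fun_triangle_root])+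

text \<open>A functional has one numerical argument, so counter, previous value and parameter of the
  step are packed into one nested pair \<open>z\<close>.\<close>

lemma rec_fun_rec_nat [rec_intros]:
  assumes "rec_fun b" "rec_fun (\<lambda>orc z. s orc (psnd (psnd z)) (pfst z) (pfst (psnd z)))" "rec_fun n"
  shows "rec_fun (\<lambda>orc x. rec_nat (b orc x) (s orc x) (n orc x))"
proof -
  obtain gb gs gn where b: "\<And>orc x. eval orc gb [x] (b orc x)"
    and s: "\<And>orc z. eval orc gs [z] (s orc (psnd (psnd z)) (pfst z) (pfst (psnd z)))"
    and n: "\<And>orc x. eval orc gn [x] (n orc x)"
    using assms unfolding rec_fun_def by blast
  let ?g = "Comp gs [Comp recf_pair [Proj 0, Comp recf_pair [Proj 1, Proj 2]]]"
  have "eval orc ?g [i, y, x] (s orc x i y)" for orc i y x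
  proof (rule eval_Comp1)
    show "eval orc (Comp recf_pair [Proj 0, Comp recf_pair [Proj 1, Proj 2]]) [i, y, x]
        (prod_encode (i, prod_encode (y, x)))"
      by (intro eval_Comp2[OF _ _ eval_pair] eval_Proj) auto
    show "eval orc gs [prod_encode (i, prod_encode (y, x))] (s orc x i y)"
      using s[of orc "prod_encode (i, prod_encode (y, x))"] by simp
  qed
  then have "eval orc (PrimRec gb ?g) [k, x] (rec_nat (b orc x) (s orc x) k)" for orc k x
    by (intro eval_PrimRec[where h = "rec_nat (b orc x) (s orc x)"]) (simp_all add: b)
  then have "eval orc (Comp (PrimRec gb ?g) [gn, Proj 0]) [x]
      (rec_nat (b orc x) (s orc x) (n orc x))" for orc x
    by (intro eval_Comp2[OF n]) (auto intro: eval_Proj)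
  then show ?thesis unfolding rec_fun_def by blast
qed

lemma rec_fun_sum [rec_intros]:
  assumes "rec_fun (\<lambda>orc z. f orc (psnd z) (pfst z))" "rec_fun n"
  shows "rec_fun (\<lambda>orc x. \<Sum>i<n orc x. f orc x i)"
proof -
  have *: "(\<Sum>i<k. f orc x i) = rec_nat 0 (\<lambda>i y. y + f orc x i) k" for orc x k
    by (induction k) auto
  have "rec_fun (\<lambda>orc z. f orc (psnd (psnd z)) (pfst z))"
    using rec_fun_compose[OF assms(1), of "\<lambda>_ z. prod_encode (pfst z, psnd (psnd z))"]
    by (simp add: rec_intros)
  then show ?thesis
    unfolding * by (intro rec_intros assms(2))
qed

lemma rec_fun_power [rec_intros]:
  assumes "rec_fun f" "rec_fun n" shows "rec_fun (\<lambda>orc x. f orc x ^ n orc x)"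
proof -
  have *: "a ^ k = rec_nat 1 (\<lambda>i y. a * y) k" for a k :: nat
    by (induction k) auto
  show ?thesis unfolding *
    by (intro rec_intros assms rec_fun_compose[OF assms(1)])
qed

section \<open>Decidable predicates and bounded quantifiers\<close>

lemma rec_fun_of_bool [rec_intros]: "rec_pred P \<Longrightarrow> rec_fun (\<lambda>orc x. of_bool (P orc x))"
  by (simp add: rec_pred_def)

lemma rec_pred_compose:
  "rec_pred P \<Longrightarrow> rec_fun f \<Longrightarrow> rec_pred (\<lambda>orc x. P orc (f orc x))"
  unfolding rec_pred_def by (rule rec_fun_compose)

lemma rec_pred_compose2:
  assumes "rec_pred (\<lambda>orc z. P orc (pfst z) (psnd z))" "rec_fun f" "rec_fun g"
  shows "rec_pred (\<lambda>orc x. P orc (f orc x) (g orc x))"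
  using rec_pred_compose[OF assms(1) rec_fun_pair[OF assms(2,3)]] by simp

lemma rec_pred_const [rec_intros]: "rec_pred (\<lambda>orc x. c)"
  unfolding rec_pred_def by (rule rec_intros)

lemma rec_pred_oracle [rec_intros]:
  assumes "rec_fun f" shows "rec_pred (\<lambda>orc x. f orc x \<in> orc)"
proof -
  obtain g where g: "\<And>orc x. eval orc g [x] (f orc x)"
    using assms unfolding rec_fun_def by blast
  have "eval orc (Comp Oracle [g]) [x] (of_bool (f orc x \<in> orc))" for orc x
    using eval.query[of orc "f orc x" "[]"] by (intro eval_Comp1[OF g]) (simp add: of_bool_def)
  then show ?thesis unfolding rec_pred_def rec_fun_def by blast
qed

lemma rec_pred_le [rec_intros]:
  assumes "rec_fun f" "rec_fun g" shows "rec_pred (\<lambda>orc x. f orc x \<le> g orc x)"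
proof -
  have *: "of_bool (a \<le> b) = 1 - (a - b)" for a b :: nat by auto
  show ?thesis unfolding rec_pred_def * by (intro rec_intros assms)
qed

lemma rec_pred_conj [rec_intros]:
  assumes "rec_pred P" "rec_pred Q" shows "rec_pred (\<lambda>orc x. P orc x \<and> Q orc x)"
  using assms unfolding rec_pred_def of_bool_conj by (rule rec_fun_mult)

lemma rec_pred_not [rec_intros]:
  assumes "rec_pred P" shows "rec_pred (\<lambda>orc x. \<not> P orc x)"
proof -
  have *: "of_bool (\<not> b) = 1 - (of_bool b :: nat)" for b by auto
  show ?thesis unfolding rec_pred_def * by (intro rec_intros assms)
qed

lemma rec_pred_disj [rec_intros]:
  assumes "rec_pred P" "rec_pred Q" shows "rec_pred (\<lambda>orc x. P orc x \<or> Q orc x)"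
proof -
  have *: "(b \<or> c) = (\<not> (\<not> b \<and> \<not> c))" for b c by auto
  show ?thesis unfolding * by (intro rec_intros assms)
qed

lemma rec_pred_imp [rec_intros]:
  assumes "rec_pred P" "rec_pred Q" shows "rec_pred (\<lambda>orc x. P orc x \<longrightarrow> Q orc x)"
  unfolding imp_conv_disj by (intro rec_intros assms)

lemma rec_pred_iff [rec_intros]:
  assumes "rec_pred P" "rec_pred Q" shows "rec_pred (\<lambda>orc x. P orc x \<longleftrightarrow> Q orc x)"
  unfolding iff_conv_conj_imp by (intro rec_intros assms)

lemma rec_pred_less [rec_intros]:
  assumes "rec_fun f" "rec_fun g" shows "rec_pred (\<lambda>orc x. f orc x < g orc x)"
  unfolding not_le[symmetric] by (intro rec_intros assms)

lemma rec_pred_eq [rec_intros]: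
  assumes "rec_fun f" "rec_fun g" shows "rec_pred (\<lambda>orc x. f orc x = (g orc x :: nat))"
  unfolding order_eq_iff by (intro rec_intros assms)

lemma rec_fun_if [rec_intros]:
  assumes "rec_pred P" "rec_fun f" "rec_fun g"
  shows "rec_fun (\<lambda>orc x. if P orc x then f orc x else g orc x)"
proof -
  have *: "(if b then m else n) = of_bool b * m + of_bool (\<not> b) * n" for b and m n :: nat by auto
  show ?thesis unfolding * by (intro rec_intros assms)
qed

lemma rec_pred_all_less [rec_intros]:
  assumes "rec_pred (\<lambda>orc z. P orc (psnd z) (pfst z))" "rec_fun n"
  shows "rec_pred (\<lambda>orc x. \<forall>i<n orc x. P orc x i)"
proof -
  \<comment> \<open>The sum counts the counterexamples below \<open>k\<close>.\<close>
  have *: "(\<forall>i<k. P orc x i) \<longleftrightarrow> (\<Sum>i<k. of_bool (\<not> P orc x i)) = (0::nat)" for k orc x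
    by auto
  show ?thesis unfolding * by (intro rec_intros assms)
qed

section \<open>Lists of numbers\<close>

definition cons_code :: "nat \<Rightarrow> nat \<Rightarrow> nat" where "cons_code x l = Suc (prod_encode (x, l))"
definition hd_code :: "nat \<Rightarrow> nat" where "hd_code l = pfst (l - 1)"
definition tl_code :: "nat \<Rightarrow> nat" where "tl_code l = psnd (l - 1)"
text \<open>Iterated tails make the entries accessible by primitive recursion; the code 0 signals
  that the list is exhausted.\<close>

definition drop_code :: "nat \<Rightarrow> nat \<Rightarrow> nat" where
  "drop_code l i = rec_nat l (\<lambda>_. tl_code) i"

lemma list_decode_cons_code [simp]: "list_decode (cons_code x l) = x # list_decode l"
  by (simp add: cons_code_def)

lemma list_decode_eq_Nil [simp]: "list_decode n = [] \<longleftrightarrow> n = 0"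
  by (metis list_decode.simps(1) list_decode_eq)

lemma list_decode_pos: "n \<noteq> 0 \<Longrightarrow> list_decode n = hd_code n # list_decode (tl_code n)"
  by (cases n) (auto simp: hd_code_def tl_code_def split: prod.splits)

lemma list_decode_tl_code: "list_decode (tl_code n) = tl (list_decode n)"
proof (cases "n = 0")
  case True
  \<comment> \<open>For the empty list \<open>0 - 1\<close> is truncated to 0, so the tail is coded
    by 0 again.\<close>
  have "prod_decode 0 = (0, 0)" by (simp add: prod_decode_eq)
  with True show ?thesis by (simp add: tl_code_def)
qed (simp add: list_decode_pos)

lemma list_decode_drop_code: "list_decode (drop_code l i) = drop i (list_decode l)"
  by (induction i) (simp_all add: drop_code_def list_decode_tl_code drop_Suc tl_drop)

lemma drop_code_eq_0: "drop_code l i = 0 \<longleftrightarrow> length (list_decode l) \<le> i"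
  by (metis list_decode_eq_Nil list_decode_drop_code drop_eq_Nil)

lemma less_length_list_decode: "i < length (list_decode l) \<longleftrightarrow> drop_code l i \<noteq> 0"
  by (simp add: drop_code_eq_0 not_le)

lemma nth_list_decode:
  assumes "i < length (list_decode l)"
  shows "list_decode l ! i = hd_code (drop_code l i)"
proof -
  have "hd_code (drop_code l i) # list_decode (tl_code (drop_code l i)) = drop i (list_decode l)"
    using assms by (metis list_decode_drop_code list_decode_pos less_length_list_decode)
  then show ?thesis using assms by (metis hd_drop_conv_nth list.sel(1))
qed

lemma length_list_decode_le: "length (list_decode l) \<le> l"
proof (induction l rule: less_induct)
  case (less l)
  show ?case
  proof (cases l)
    case (Suc k)
    obtain x y where xy: "prod_decode k = (x, y)" by force
    then have "y \<le> k" by (metis le_prod_encode_2 prod_decode_inverse)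
    then show ?thesis using less[of y] Suc xy by simp
  qed simp
qed

lemma rec_fun_cons_code [rec_intros]:
  "rec_fun f \<Longrightarrow> rec_fun g \<Longrightarrow> rec_fun (\<lambda>orc x. cons_code (f orc x) (g orc x))"
  unfolding cons_code_def by (intro rec_intros)

lemma rec_fun_hd_code [rec_intros]: "rec_fun f \<Longrightarrow> rec_fun (\<lambda>orc x. hd_code (f orc x))"
  unfolding hd_code_def by (intro rec_intros)

lemma rec_fun_tl_code [rec_intros]: "rec_fun f \<Longrightarrow> rec_fun (\<lambda>orc x. tl_code (f orc x))"
  unfolding tl_code_def by (intro rec_intros)

lemma rec_fun_drop_code [rec_intros]:
  "rec_fun f \<Longrightarrow> rec_fun g \<Longrightarrow> rec_fun (\<lambda>orc x. drop_code (f orc x) (g orc x))"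
  unfolding drop_code_def by (intro rec_intros)

lemma rec_pred_Ball_list [rec_intros]:
  assumes "rec_pred (\<lambda>orc z. P orc (psnd z) (pfst z))" "rec_fun l"
  shows "rec_pred (\<lambda>orc x. \<forall>i\<in>set (list_decode (l orc x)). P orc x i)"
proof -
  \<comment> \<open>A list is no longer than its code, so indices below the code reach all
    entries.\<close>
  have *: "(\<forall>i\<in>set (list_decode k). Q i) \<longleftrightarrow>
      (\<forall>i<k. drop_code k i \<noteq> 0 \<longrightarrow> Q (hd_code (drop_code k i)))" for Q k
    using length_list_decode_le[of k]
    by (auto simp: all_set_conv_all_nth nth_list_decode drop_code_eq_0 not_le)
  show ?thesis unfolding *
    by (intro rec_intros assms rec_fun_compose[OF assms(2)] rec_pred_compose2[OF assms(1)])
qed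

lemma rec_pred_Bex_list [rec_intros]:
  assumes "rec_pred (\<lambda>orc z. P orc (psnd z) (pfst z))" "rec_fun l"
  shows "rec_pred (\<lambda>orc x. \<exists>i\<in>set (list_decode (l orc x)). P orc x i)"
proof -
  have *: "(\<exists>i\<in>X. Q i) \<longleftrightarrow> \<not> (\<forall>i\<in>X. \<not> Q i)" for X and Q :: "nat \<Rightarrow> bool" by auto
  show ?thesis unfolding * by (intro rec_intros assms)
qed

lemma rec_pred_mem_list [rec_intros]:
  assumes "rec_fun f" "rec_fun l"
  shows "rec_pred (\<lambda>orc x. f orc x \<in> set (list_decode (l orc x)))"
proof -
  have *: "i \<in> X \<longleftrightarrow> (\<exists>j\<in>X. j = i)" for i :: nat and X by auto
  show ?thesis unfolding * by (intro rec_intros assms rec_fun_compose[OF assms(1)])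
qed

section \<open>Evaluation with bounded resources\<close>

text \<open>\<open>run f orc t xs\<close> is \<open>0\<close> if the bound \<open>t\<close> does not suffice and \<open>Suc y\<close> if the value \<open>y\<close> is found.
  The bound \<open>t\<close> limits unbounded search as well as the oracle queries, so that only the part of
  the oracle below \<open>t\<close> matters.\<close>

primrec run :: "recf \<Rightarrow> nat set \<Rightarrow> nat \<Rightarrow> nat list \<Rightarrow> nat" where
  "run Zero = (\<lambda>orc t xs. 1)"
| "run Succ = (\<lambda>orc t xs. if xs = [] then 0 else Suc (Suc (hd xs)))"
| "run (Proj i) = (\<lambda>orc t xs. if i < length xs then Suc (xs ! i) else 0)"
| "run Oracle = (\<lambda>orc t xs. if xs = [] \<or> t \<le> hd xs then 0 else Suc (of_bool (hd xs \<in> orc)))"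
| "run (Comp f gs) = (\<lambda>orc t xs. let vs = map (\<lambda>r. r orc t xs) (map run gs) in
    if 0 \<in> set vs then 0 else run f orc t (map (\<lambda>v. v - 1) vs))"
| "run (PrimRec f g) = (\<lambda>orc t xs. case xs of [] \<Rightarrow> 0 | n # ys \<Rightarrow>
    rec_nat (run f orc t ys)
      (\<lambda>i r. if r = 0 then 0 else run g orc t (i # (r - 1) # ys)) n)"
| "run (Mu f) = (\<lambda>orc t xs. \<Sum>n<t.
    if run f orc t (n # xs) = 1 \<and> (\<forall>m<n. 1 < run f orc t (m # xs)) then Suc n else 0)"

text \<open>At most one summand is nonzero: the value 1 at the smaller of two candidates contradicts
  the demand for larger values below the other. Thus a sum, under which recursive functionals are
  closed, expresses the search.\<close>

lemma run_Mu_eq: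
  assumes "n < t" "run f orc t (n # xs) = 1" "\<forall>m<n. 1 < run f orc t (m # xs)"
  shows "run (Mu f) orc t xs = Suc n"
proof -
  have "run (Mu f) orc t xs = (\<Sum>k<t. if k = n then Suc n else 0)"
    unfolding run.simps
  proof (rule sum.cong[OF refl])
    fix k
    show "(if run f orc t (k # xs) = 1 \<and> (\<forall>m<k. 1 < run f orc t (m # xs)) then Suc k else 0)
      = (if k = n then Suc n else 0)"
      using assms(2,3) by (cases k n rule: linorder_cases) auto
  qed
  then show ?thesis using assms(1) by simp
qed

lemma run_sound: "run f orc t xs = Suc y \<Longrightarrow> eval orc f xs y"
proof (induction f arbitrary: xs y)
  case Zero
  then show ?case by (auto intro: eval.zero)
next
  case Succ
  then show ?case by (cases xs) (auto intro: eval.succ)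
next
  case (Proj i)
  then show ?case by (auto intro: eval.proj split: if_splits)
next
  case Oracle
  then show ?case
    using eval.query[of orc "hd xs" "tl xs"] by (cases xs) (auto split: if_splits)
next
  case (Comp f gs)
  let ?ys = "map (\<lambda>g. run g orc t xs - 1) gs"
  have nz: "run g orc t xs \<noteq> 0" if "g \<in> set gs" for g
    using Comp.prems that by (force simp: Let_def split: if_splits)
  then have "list_all2 (\<lambda>g y. eval orc g xs y) gs ?ys"
    using Comp.IH(2) by (auto simp: list_all2_conv_all_nth)
  moreover have "run f orc t ?ys = Suc y"
    using Comp.prems by (simp add: Let_def o_def split: if_splits)
  ultimately show ?case using Comp.IH(1) by (blast intro: eval.comp)
next
  case (PrimRec f g)
  then obtain n ys where xs: "xs = n # ys" by (cases xs) auto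
  have "rec_nat (run f orc t ys)
      (\<lambda>i r. if r = 0 then 0 else run g orc t (i # (r - 1) # ys)) n = Suc y
      \<Longrightarrow> eval orc (PrimRec f g) (n # ys) y"
  proof (induction n arbitrary: y)
    case 0
    then show ?case by (auto intro: eval.primrec_0 PrimRec.IH)
  next
    case (Suc n)
    let ?r = "rec_nat (run f orc t ys)
      (\<lambda>i r. if r = 0 then 0 else run g orc t (i # (r - 1) # ys)) n"
    have "?r = Suc (?r - 1)" using Suc.prems by (auto split: if_splits)
    then have "eval orc (PrimRec f g) (n # ys) (?r - 1)" by (rule Suc.IH)
    moreover have "eval orc g (n # (?r - 1) # ys) y"
      using Suc.prems by (intro PrimRec.IH(2)) (simp split: if_splits)
    ultimately show ?case by (rule eval.primrec_Suc)
  qed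
  then show ?case using PrimRec.prems xs by simp
next
  case (Mu f)
  then have "(\<Sum>n<t. if run f orc t (n # xs) = 1 \<and> (\<forall>m<n. 1 < run f orc t (m # xs))
      then Suc n else 0) \<noteq> 0"
    by (simp del: sum_eq_0_iff)
  then obtain n where n: "n < t" "run f orc t (n # xs) = 1" "\<forall>m<n. 1 < run f orc t (m # xs)"
    by (auto split: if_splits)
  have "\<exists>z>0. eval orc f (m # xs) z" if "m < n" for m
    using n(3) that Mu.IH[of "m # xs" "run f orc t (m # xs) - 1"]
    by (intro exI[of _ "run f orc t (m # xs) - 1"]) auto
  moreover have "y = n" using run_Mu_eq[OF n] Mu.prems by simp
  ultimately show ?case using Mu.IH[of "n # xs" 0] n(2) by (auto intro: eval.mu)
qed

text \<open>Claiming the value for all large bounds lets finitely many subcomputations be combined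
  at a common bound, without an argument that \<open>run\<close> is monotone in
  \<open>t\<close>.\<close>

lemma run_complete: "eval orc f xs y \<Longrightarrow> \<forall>\<^sub>F t in sequentially. run f orc t xs = Suc y"
proof (induction rule: eval.induct)
  case (query x xs)
  show ?case using eventually_gt_at_top[of x] by eventually_elim auto
next
  case (comp xs gs ys f z)
  have "\<forall>\<^sub>F t in sequentially. \<forall>i\<in>{..<length gs}. run (gs ! i) orc t xs = Suc (ys ! i)"
    using comp.IH(1) by (intro eventually_ball_finite) (auto simp: list_all2_conv_all_nth)
  then show ?case using comp.IH(2)
  proof eventually_elim
    case (elim t)
    have "map (\<lambda>g. run g orc t xs) gs = map Suc ys"
      using elim(1) comp.IH(1) by (intro nth_equalityI) (auto simp: list_all2_conv_all_nth)
    then have *: "map (\<lambda>r. r orc t xs) (map run gs) = map Suc ys" by (simp add: o_def)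
    show ?case unfolding run.simps * Let_def using elim(2) by (simp add: o_def)
  qed
next
  case (primrec_Suc f g n xs y z)
  from primrec_Suc.IH show ?case by eventually_elim simp
next
  case (mu f n xs)
  have "\<forall>\<^sub>F t in sequentially. \<forall>m\<in>{..<n}. 1 < run f orc t (m # xs)"
  proof (rule eventually_ball_finite, simp, safe)
    fix m assume "m < n"
    then obtain y where "y > 0" "\<forall>\<^sub>F t in sequentially. run f orc t (m # xs) = Suc y"
      using mu.IH(2) by blast
    then show "\<forall>\<^sub>F t in sequentially. 1 < run f orc t (m # xs)"
      by (auto elim: eventually_mono)
  qed
  with mu.IH(1) eventually_gt_at_top[of n] show ?case
  proof eventually_elim
    case (elim t)
    then show ?case using run_Mu_eq[of n t f orc xs] by simp
  qed
qed (auto simp del: run.simps(7))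

lemma eval_iff_run: "(\<exists>y. eval orc f xs y) \<longleftrightarrow> (\<exists>t. run f orc t xs \<noteq> 0)"
proof
  assume "\<exists>y. eval orc f xs y"
  then obtain y where "\<forall>\<^sub>F t in sequentially. run f orc t xs = Suc y"
    using run_complete by blast
  then obtain t where "run f orc t xs = Suc y" unfolding eventually_sequentially by blast
  then show "\<exists>t. run f orc t xs \<noteq> 0" by (intro exI[of _ t]) simp
next
  assume "\<exists>t. run f orc t xs \<noteq> 0"
  then show "\<exists>y. eval orc f xs y" using run_sound by (metis not0_implies_Suc)
qed

text \<open>The use principle: a query at or above \<open>t\<close> fails without consulting the
  oracle. It allows finite conditions to settle computations.\<close>

lemma run_cong:
  assumes "\<And>x. x < t \<Longrightarrow> x \<in> orc \<longleftrightarrow> x \<in> orc'"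
  shows "run f orc t xs = run f orc' t xs"
proof (induction f arbitrary: xs)
  case Oracle
  then show ?case using assms by simp
next
  case (Comp f gs)
  have "map (\<lambda>r. r orc t xs) (map run gs) = map (\<lambda>r. r orc' t xs) (map run gs)"
    using Comp.IH(2) by simp
  then show ?case by (simp only: run.simps Comp.IH(1))
next
  case (PrimRec f g)
  then show ?case by (simp only: run.simps)
next
  case (Mu f)
  then show ?case by (simp only: run.simps)
qed simp_all

text \<open>The program \<open>f\<close> is fixed and the induction runs over it, so no universal
  program is needed. The decidable family \<open>ora\<close> covers both the true oracle and a
  finite oracle given by a list code.\<close>

lemma rec_fun_run:
  assumes orc: "rec_pred (\<lambda>orc z. pfst z \<in> ora orc (psnd z))"
    and "rec_fun s" "rec_fun t" "rec_fun l"
  shows "rec_fun (\<lambda>orc x. run f (ora orc (s orc x)) (t orc x) (list_decode (l orc x)))"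
  using assms(2-)
proof (induction f arbitrary: s t l)
  case Zero
  show ?case unfolding run.simps by (rule rec_fun_const)
next
  case Succ
  have *: "run Succ orc t (list_decode l) = (if l = 0 then 0 else Suc (Suc (hd_code l)))" for orc t l
    by (auto simp: list_decode_pos)
  show ?case unfolding * by (intro rec_intros Succ)
next
  case (Proj i)
  have *: "run (Proj i) orc t (list_decode l) =
      (if drop_code l i = 0 then 0 else Suc (hd_code (drop_code l i)))" for orc t l
    by (auto simp: drop_code_eq_0 nth_list_decode)
  show ?case unfolding * by (intro rec_intros Proj)
next
  case Oracle
  have *: "run Oracle orc t (list_decode l) =
      (if l = 0 \<or> t \<le> hd_code l then 0 else Suc (of_bool (hd_code l \<in> orc)))" for orc t l
    by (auto simp: list_decode_pos)
  show ?case unfolding *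
    by (intro rec_intros Oracle rec_pred_compose2[OF orc])
next
  case (Comp f gs)
  define v where "v = (\<lambda>g orc x. run g (ora orc (s orc x)) (t orc x) (list_decode (l orc x)))"
  have v: "rec_fun (v g)" if "g \<in> set gs" for g
    unfolding v_def by (rule Comp.IH(2)[OF that Comp.prems])
  have nz: "rec_pred (\<lambda>orc x. \<exists>g\<in>set gs. v g orc x = 0)"
    using v by (induction gs) (auto intro!: rec_intros)
  have args: "rec_fun (\<lambda>orc x. list_encode (map (\<lambda>g. v g orc x - 1) gs))"
    using v
  proof (induction gs)
    case (Cons g gs)
    have "list_encode (map (\<lambda>g. v g orc x - 1) (g # gs)) =
        cons_code (v g orc x - 1) (list_encode (map (\<lambda>g. v g orc x - 1) gs))" for orc x
      by (simp add: cons_code_def)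
    with Cons show ?case by (auto intro!: rec_intros)
  qed (auto intro: rec_intros)
  have *: "run (Comp f gs) (ora orc (s orc x)) (t orc x) (list_decode (l orc x)) =
     (if \<exists>g\<in>set gs. v g orc x = 0 then 0 else
       run f (ora orc (s orc x)) (t orc x)
         (list_decode (list_encode (map (\<lambda>g. v g orc x - 1) gs))))" for orc x
    by (auto simp: Let_def v_def o_def image_iff)
  show ?case unfolding *
    by (intro rec_intros nz Comp.IH(1) Comp.prems args)
next
  case (PrimRec f g)
  have *: "run (PrimRec f g) orc t (list_decode l) = (if l = 0 then 0 else
    rec_nat (run f orc t (list_decode (tl_code l)))
      (\<lambda>i r. if r = 0 then 0 else
        run g orc t (list_decode (cons_code i (cons_code (r - 1) (tl_code l))))) (hd_code l))" for orc t l
    by (cases "l = 0") (simp_all add: list_decode_pos[of l] cong: if_cong)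
  show ?case unfolding *
    by (intro rec_intros PrimRec rec_fun_compose[OF PrimRec.prems(1)]
        rec_fun_compose[OF PrimRec.prems(2)] rec_fun_compose[OF PrimRec.prems(3)])
next
  case (Mu f)
  have *: "run (Mu f) orc t (list_decode l) = (\<Sum>n<t.
    if run f orc t (list_decode (cons_code n l)) = 1 \<and>
      (\<forall>m<n. 1 < run f orc t (list_decode (cons_code m l))) then Suc n else 0)" for orc t l
    by (simp only: run.simps list_decode_cons_code)
  show ?case unfolding *
    by (intro rec_intros Mu rec_fun_compose[OF Mu.prems(1)]
        rec_fun_compose[OF Mu.prems(2)] rec_fun_compose[OF Mu.prems(3)])
qed

lemma rec_fun_run_oracle [rec_intros]:
  assumes "rec_fun t" "rec_fun l"
  shows "rec_fun (\<lambda>orc x. run f orc (t orc x) (list_decode (l orc x)))"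
  by (rule rec_fun_run[where ora = "\<lambda>orc _. orc" and s = "\<lambda>_ _. 0"]) (intro rec_intros assms)+

lemma rec_fun_run_finite [rec_intros]:
  assumes "rec_fun s" "rec_fun t" "rec_fun l"
  shows "rec_fun (\<lambda>orc x. run f (set (list_decode (s orc x))) (t orc x) (list_decode (l orc x)))"
  by (rule rec_fun_run[where ora = "\<lambda>_ s. set (list_decode s)" and s = s]) (intro rec_intros assms)+

text \<open>Unbounded search for the witness. \<open>Mu\<close> puts the search variable first and
  stops at the value 0, so it is applied to the indicator of the negation with the arguments
  swapped.\<close>

lemma ce_rel_projection:
  assumes "rec_pred (\<lambda>orc z. P orc (pfst z) (psnd z))"
  shows "ce_rel orc {n. \<exists>w. P orc n w}"
proof -
  have "rec_fun (\<lambda>orc z. of_bool (\<not> P orc (psnd z) (pfst z)))"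
    by (intro rec_intros rec_pred_compose2[OF assms])
  then obtain g where g: "\<And>z. eval orc g [z] (of_bool (\<not> P orc (psnd z) (pfst z)))"
    unfolding rec_fun_def by blast
  have g': "eval orc (Comp g [recf_pair]) [w, n] (of_bool (\<not> P orc n w))" for w n
    using g[of "prod_encode (w, n)"] by (intro eval_Comp1[OF eval_pair]) simp
  define h where "h = Mu (Comp g [recf_pair])"
  have eval_h: "(\<exists>y. eval orc h [n] y) \<longleftrightarrow> (\<exists>w. P orc n w)" for n
  proof
    assume "\<exists>w. P orc n w"
    then have L: "P orc n (LEAST w. P orc n w)" by (rule LeastI_ex)
    have "eval orc (Comp g [recf_pair]) [LEAST w. P orc n w, n] 0"
      using g'[of "LEAST w. P orc n w" n] L by simp
    moreover have "eval orc (Comp g [recf_pair]) [m, n] 1" if "m < (LEAST w. P orc n w)" for m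
      using g'[of m n] not_less_Least[OF that] by simp
    ultimately show "\<exists>y. eval orc h [n] y" unfolding h_def by (blast intro: eval.mu)
  next
    assume "\<exists>y. eval orc h [n] y"
    then obtain t where "run h orc t [n] \<noteq> 0" unfolding eval_iff_run by blast
    then obtain w where "run (Comp g [recf_pair]) orc t [w, n] = Suc 0"
      unfolding h_def run.simps(7) by (auto split: if_splits simp del: run.simps)
    then have "eval orc (Comp g [recf_pair]) [w, n] 0" by (rule run_sound)
    \<comment> \<open>Two values of one program on the same input agree, because \<open>run\<close>
      returns each of them for all large bounds.\<close>
    from run_complete[OF this] run_complete[OF g'[of w n]]
    have "\<forall>\<^sub>F t in sequentially. (0::nat) = of_bool (\<not> P orc n w)"
      by eventually_elim simp
    then show "\<exists>w. P orc n w" by auto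
  qed
  show ?thesis unfolding ce_rel_def using eval_h by blast
qed

lemma ce_rel_run: "ce_rel orc S \<Longrightarrow> \<exists>f. \<forall>n. n \<in> S \<longleftrightarrow> (\<exists>t. run f orc t [n] \<noteq> 0)"
  unfolding ce_rel_def eval_iff_run by blast

section \<open>Rational-valued functionals\<close>

text \<open>Exact rational arithmetic: a difference of naturals as numerator provides signs, and a
  positive denominator reduces comparisons to naturals.\<close>

definition rec_rat :: "(nat set \<Rightarrow> nat \<Rightarrow> real) \<Rightarrow> bool" where
  "rec_rat f \<longleftrightarrow> (\<exists>p q r. rec_fun p \<and> rec_fun q \<and> rec_fun r \<and>
    (\<forall>orc x. 0 < r orc x \<and> f orc x = (real (p orc x) - real (q orc x)) / real (r orc x)))"

lemma rec_ratI:
  assumes "rec_fun p" "rec_fun q" "rec_fun r" "\<And>orc x. 0 < r orc x"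
    "\<And>orc x. f orc x = (real (p orc x) - real (q orc x)) / real (r orc x)"
  shows "rec_rat f"
  using assms unfolding rec_rat_def by blast

lemma rec_rat_fraction [rec_intros]:
  assumes "rec_fun f" "rec_fun g"
  shows "rec_rat (\<lambda>orc x. real (f orc x) / real (g orc x))"
proof (rule rec_ratI)
  \<comment> \<open>Division by 0 yields 0 in HOL, so a zero denominator is replaced by the fraction
    0/1.\<close>
  show "rec_fun (\<lambda>orc x. if g orc x = 0 then 0 else f orc x)"
    "rec_fun (\<lambda>orc x. 0)" "rec_fun (\<lambda>orc x. if g orc x = 0 then 1 else g orc x)"
    by (intro rec_intros assms)+
qed auto

lemma rec_rat_of_nat [rec_intros]: "rec_fun f \<Longrightarrow> rec_rat (\<lambda>orc x. real (f orc x))"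
  using rec_rat_fraction[OF _ rec_fun_const[of 1]] by simp

lemma rec_rat_0 [rec_intros]: "rec_rat (\<lambda>orc x. 0)"
  using rec_rat_of_nat[OF rec_fun_const[of 0]] by simp

lemma rec_rat_1 [rec_intros]: "rec_rat (\<lambda>orc x. 1)"
  using rec_rat_of_nat[OF rec_fun_const[of 1]] by simp

lemma rec_rat_add [rec_intros]:
  assumes "rec_rat f" "rec_rat g" shows "rec_rat (\<lambda>orc x. f orc x + g orc x)"
proof -
  obtain p q r where f: "rec_fun p" "rec_fun q" "rec_fun r" "\<And>orc x. 0 < r orc x"
    "\<And>orc x. f orc x = (real (p orc x) - real (q orc x)) / real (r orc x)"
    using assms(1) unfolding rec_rat_def by blast
  obtain p' q' r' where g: "rec_fun p'" "rec_fun q'" "rec_fun r'" "\<And>orc x. 0 < r' orc x"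
    "\<And>orc x. g orc x = (real (p' orc x) - real (q' orc x)) / real (r' orc x)"
    using assms(2) unfolding rec_rat_def by blast
  show ?thesis
  proof (rule rec_ratI)
    show "rec_fun (\<lambda>orc x. p orc x * r' orc x + p' orc x * r orc x)"
      "rec_fun (\<lambda>orc x. q orc x * r' orc x + q' orc x * r orc x)"
      "rec_fun (\<lambda>orc x. r orc x * r' orc x)"
      by (intro rec_intros f(1-3) g(1-3))+
  next
    fix orc x
    have "real (r orc x) \<noteq> 0" "real (r' orc x) \<noteq> 0" using f(4) g(4) by (simp_all add: less_imp_neq)
    then show "f orc x + g orc x =
        (real (p orc x * r' orc x + p' orc x * r orc x)
          - real (q orc x * r' orc x + q' orc x * r orc x)) / real (r orc x * r' orc x)"
      by (simp add: f(5) g(5) field_simps)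
  qed (use f(4) g(4) in simp)
qed

lemma rec_rat_mult [rec_intros]:
  assumes "rec_rat f" "rec_rat g" shows "rec_rat (\<lambda>orc x. f orc x * g orc x)"
proof -
  obtain p q r where f: "rec_fun p" "rec_fun q" "rec_fun r" "\<And>orc x. 0 < r orc x"
    "\<And>orc x. f orc x = (real (p orc x) - real (q orc x)) / real (r orc x)"
    using assms(1) unfolding rec_rat_def by blast
  obtain p' q' r' where g: "rec_fun p'" "rec_fun q'" "rec_fun r'" "\<And>orc x. 0 < r' orc x"
    "\<And>orc x. g orc x = (real (p' orc x) - real (q' orc x)) / real (r' orc x)"
    using assms(2) unfolding rec_rat_def by blast
  show ?thesis
  proof (rule rec_ratI)
    show "rec_fun (\<lambda>orc x. p orc x * p' orc x + q orc x * q' orc x)"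
      "rec_fun (\<lambda>orc x. p orc x * q' orc x + q orc x * p' orc x)"
      "rec_fun (\<lambda>orc x. r orc x * r' orc x)"
      by (intro rec_intros f(1-3) g(1-3))+
  qed (use f(4) g(4) in \<open>simp_all add: f(5) g(5) algebra_simps\<close>)
qed

lemma rec_rat_minus [rec_intros]:
  assumes "rec_rat f" shows "rec_rat (\<lambda>orc x. - f orc x)"
proof -
  obtain p q r where f: "rec_fun p" "rec_fun q" "rec_fun r" "\<And>orc x. 0 < r orc x"
    "\<And>orc x. f orc x = (real (p orc x) - real (q orc x)) / real (r orc x)"
    using assms unfolding rec_rat_def by blast
  show ?thesis
    by (rule rec_ratI[OF f(2,1,3,4)]) (simp add: f(5) minus_divide_left)
qed

lemma rec_rat_diff [rec_intros]:
  assumes "rec_rat f" "rec_rat g" shows "rec_rat (\<lambda>orc x. f orc x - g orc x)"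
  unfolding diff_conv_add_uminus by (intro rec_intros assms)

lemma rec_pred_rat_le [rec_intros]:
  assumes "rec_rat f" "rec_rat g" shows "rec_pred (\<lambda>orc x. f orc x \<le> g orc x)"
proof -
  obtain p q r where h: "rec_fun p" "rec_fun q" "rec_fun r" "\<And>orc x. 0 < r orc x"
    "\<And>orc x. g orc x - f orc x = (real (p orc x) - real (q orc x)) / real (r orc x)"
    using rec_rat_diff[OF assms(2,1)] unfolding rec_rat_def by blast
  have "f orc x \<le> g orc x \<longleftrightarrow> q orc x \<le> p orc x" for orc x
  proof -
    have "f orc x \<le> g orc x \<longleftrightarrow> 0 \<le> g orc x - f orc x" by simp
    also have "\<dots> \<longleftrightarrow> q orc x \<le> p orc x"
      unfolding h(5) using h(4)[of orc x] by (simp add: zero_le_divide_iff)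
    finally show ?thesis .
  qed
  then show ?thesis by (simp add: rec_intros h(1,2))
qed

lemma rec_rat_if [rec_intros]:
  assumes "rec_pred P" "rec_rat f" "rec_rat g"
  shows "rec_rat (\<lambda>orc x. if P orc x then f orc x else g orc x)"
proof -
  have *: "(if b then y else z) = real (of_bool b) * y + real (of_bool (\<not> b)) * z" for b y z by auto
  show ?thesis unfolding * by (intro rec_intros assms)
qed

lemma rec_rat_min [rec_intros]:
  assumes "rec_rat f" "rec_rat g" shows "rec_rat (\<lambda>orc x. min (f orc x) (g orc x))"
  unfolding min_def by (intro rec_intros assms)

lemma rec_rat_abs [rec_intros]:
  assumes "rec_rat f" shows "rec_rat (\<lambda>orc x. \<bar>f orc x\<bar>)"
proof -
  have *: "\<bar>y\<bar> = (if 0 \<le> y then y else - y)" for y :: real by simp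
  show ?thesis unfolding * by (intro rec_intros assms)
qed

lemma rec_rat_sum [rec_intros]:
  assumes "rec_rat (\<lambda>orc z. f orc (psnd z) (pfst z))" "rec_fun n"
  shows "rec_rat (\<lambda>orc x. \<Sum>i<n orc x. f orc x i)"
proof -
  obtain p q r where f: "rec_fun p" "rec_fun q" "rec_fun r" "\<And>orc z. 0 < r orc z"
    "\<And>orc z. f orc (psnd z) (pfst z) = (real (p orc z) - real (q orc z)) / real (r orc z)"
    using assms(1) unfolding rec_rat_def by blast
  \<comment> \<open>\<open>R\<close> multiplies the first denominators, and \<open>S\<close>
    accumulates numerators over this common denominator, once for \<open>p\<close> and once for
    \<open>q\<close>.\<close>
  define R where "R = (\<lambda>orc x. rec_nat 1 (\<lambda>i y. y * r orc (prod_encode (i, x))))"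
  define S where "S = (\<lambda>h orc x. rec_nat 0 (\<lambda>i y. y * r orc (prod_encode (i, x))
    + h orc (prod_encode (i, x)) * R orc x i))"
  have R_pos: "0 < R orc x k" for orc x k
    by (induction k) (simp_all add: R_def f(4))
  have sum: "(\<Sum>i<k. f orc x i) = (real (S p orc x k) - real (S q orc x k)) / real (R orc x k)"
    for orc x k
  proof (induction k)
    case (Suc k)
    have "f orc x k = (real (p orc (prod_encode (k, x))) - real (q orc (prod_encode (k, x))))
        / real (r orc (prod_encode (k, x)))"
      using f(5)[of orc "prod_encode (k, x)"] by simp
    moreover have "S h orc x (Suc k) =
        S h orc x k * r orc (prod_encode (k, x)) + h orc (prod_encode (k, x)) * R orc x k" for h
      by (simp add: S_def)
    moreover have "R orc x (Suc k) = R orc x k * r orc (prod_encode (k, x))"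
      by (simp add: R_def)
    moreover have "real (R orc x k) \<noteq> 0" "real (r orc (prod_encode (k, x))) \<noteq> 0"
      using R_pos[of orc x k] f(4)[of orc "prod_encode (k, x)"] by simp_all
    moreover have "(a - b) / u + (c - d) / v = (a * v + c * u - (b * v + d * u)) / (u * v)"
      if "u \<noteq> 0" "v \<noteq> 0" for a b c d u v :: real
      using that by (simp add: field_simps)
    ultimately show ?case by (simp only: sum.lessThan_Suc Suc.IH of_nat_add of_nat_mult)
  qed (simp add: S_def)
  have R_rec: "rec_fun (\<lambda>orc x. R orc (g orc x) (k orc x))" if "rec_fun g" "rec_fun k" for g k
    unfolding R_def by (intro rec_intros that rec_fun_compose[OF f(3)] rec_fun_compose[OF that(1)])
  have S_rec: "rec_fun (\<lambda>orc x. S h orc x (n orc x))" if "rec_fun h" for h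
    unfolding S_def
    by (intro rec_intros assms(2) R_rec rec_fun_compose[OF f(3)] rec_fun_compose[OF that])
  show ?thesis
    by (rule rec_ratI[OF S_rec[OF f(1)] S_rec[OF f(2)] R_rec[OF rec_fun_id assms(2)] R_pos sum])
qed

lemma rec_rat_unit_rat [rec_intros]: "rec_fun f \<Longrightarrow> rec_rat (\<lambda>orc x. unit_rat (f orc x))"
  unfolding unit_rat_def case_prod_beta by (intro rec_intros)

lemma rec_rat_pos_rat [rec_intros]: "rec_fun f \<Longrightarrow> rec_rat (\<lambda>orc x. pos_rat (f orc x))"
  unfolding pos_rat_def case_prod_beta by (intro rec_intros)

lemma rec_rat_coord_rat_point [rec_intros]:
  assumes "rec_fun f" "rec_fun g" shows "rec_rat (\<lambda>orc x. coord (rat_point (f orc x)) (g orc x))"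
proof -
  have *: "coord (rat_point n) i =
      (if drop_code n i = 0 then 0 else unit_rat (hd_code (drop_code n i)))" for n i
    by (auto simp: coord_rat_point nth_list_decode less_length_list_decode)
  show ?thesis unfolding * by (intro rec_intros assms)
qed

lemma rec_rat_dist_rat_point [rec_intros]:
  assumes "rec_fun f" "rec_fun g"
  shows "rec_rat (\<lambda>orc x. dist (rat_point (f orc x)) (rat_point (g orc x)))"
proof -
  \<comment> \<open>Coded lists are no longer than their codes, so coordinates from
    \<open>m + n\<close> on vanish and the series is finite. The weights are written as quotients of
    naturals to fit \<open>rec_rat_fraction\<close>.\<close>
  have *: "dist (rat_point m) (rat_point n) =
      (\<Sum>i<m + n. real 1 / real (2 ^ i) * \<bar>coord (rat_point m) i - coord (rat_point n) i\<bar>)" for m n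
  proof -
    have "(1 / 2) ^ i * \<bar>coord (rat_point m) i - coord (rat_point n) i\<bar> = 0" if "i \<notin> {..<m + n}" for i
      using that length_list_decode_le[of m] length_list_decode_le[of n]
      by (simp add: coord_rat_point)
    then have "dist (rat_point m) (rat_point n) =
        (\<Sum>i<m + n. (1 / 2) ^ i * \<bar>coord (rat_point m) i - coord (rat_point n) i\<bar>)"
      unfolding dist_hilbert_cube_def by (intro suminf_finite) auto
    then show ?thesis by (simp add: power_divide)
  qed
  show ?thesis unfolding *
    by (intro rec_intros assms rec_fun_compose[OF assms(1)] rec_fun_compose[OF assms(2)])
qed

section \<open>Formal inclusion and disjointness of rational balls\<close>

abbreviation centre :: "nat \<Rightarrow> hilbert_cube" where "centre i \<equiv> rat_point (pfst i)"
abbreviation radius :: "nat \<Rightarrow> real" where "radius i \<equiv> pos_rat (psnd i)"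

lemma mem_rat_ball: "x \<in> rat_ball i \<longleftrightarrow> dist (centre i) x < radius i"
  by (simp add: rat_ball_def case_prod_beta)

text \<open>Decidable from the codes, since centres have exact rational distances. Inclusion can
  hold without it, for instance between large balls that both fill the cube.\<close>

definition formally_inside :: "nat \<Rightarrow> nat \<Rightarrow> bool" where
  "formally_inside i j \<longleftrightarrow> dist (centre i) (centre j) + radius i \<le> radius j"

definition formally_outside :: "nat \<Rightarrow> nat \<Rightarrow> bool" where
  "formally_outside i j \<longleftrightarrow> radius i + radius j \<le> dist (centre i) (centre j)"

lemma rec_pred_formally_inside [rec_intros]:
  "rec_fun f \<Longrightarrow> rec_fun g \<Longrightarrow> rec_pred (\<lambda>orc x. formally_inside (f orc x) (g orc x))"
  unfolding formally_inside_def by (intro rec_intros)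

lemma rec_pred_formally_outside [rec_intros]:
  "rec_fun f \<Longrightarrow> rec_fun g \<Longrightarrow> rec_pred (\<lambda>orc x. formally_outside (f orc x) (g orc x))"
  unfolding formally_outside_def by (intro rec_intros)

lemma formally_inside_subset:
  assumes "formally_inside i j" shows "rat_ball i \<subseteq> rat_ball j"
proof
  fix x assume "x \<in> rat_ball i"
  then show "x \<in> rat_ball j"
    using assms dist_triangle[of "centre j" x "centre i"]
    unfolding formally_inside_def mem_rat_ball by (simp add: dist_commute)
qed

lemma formally_outside_disjoint:
  assumes "formally_outside i j" shows "rat_ball i \<inter> rat_ball j = {}"
proof -
  have "\<not> (x \<in> rat_ball i \<and> x \<in> rat_ball j)" for x
    using assms dist_triangle[of "centre i" "centre j" x]
    unfolding formally_outside_def mem_rat_ball by (simp add: dist_commute)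
  then show ?thesis by blast
qed

section \<open>Density of rational points and covers by small balls\<close>

lemma rat_point_dense:
  assumes "0 < e" shows "\<exists>n. dist (rat_point n) x < e"
proof -
  \<comment> \<open>The tail will contribute \<open>4 * (2/3) ^ N\<close>, which has to stay below
    \<open>e / 2\<close>.\<close>
  obtain N where N: "(2/3::real) ^ N < e / 8"
    using real_arch_pow_inv[of "e / 8" "2/3"] assms by auto
  have "\<exists>k. \<bar>unit_rat k - coord x i\<bar> \<le> e / 4" for i
  proof (cases "coord x i = 0")
    case True
    have "(0::real) \<in> range unit_rat" unfolding range_unit_rat by simp
    then obtain k where "unit_rat k = 0" by (metis rangeE)
    then show ?thesis using True assms by (intro exI[of _ k]) simp
  next
    case False
    then have "0 < coord x i" using coord_bounds[of x i] by simp
    \<comment> \<open>The cut-off at 0 keeps the rational in the unit interval, where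
      \<open>unit_rat\<close> attains it.\<close>
    then have "max 0 (coord x i - e / 4) < coord x i" using assms by simp
    then obtain q where q: "q \<in> \<rat>" "max 0 (coord x i - e / 4) < q" "q < coord x i"
      using Rats_dense_in_real by blast
    then have "q \<in> range unit_rat"
      unfolding range_unit_rat using coord_bounds[of x i] by simp
    then obtain k where "unit_rat k = q" by (metis rangeE)
    then show ?thesis using q by (intro exI[of _ k]) simp
  qed
  then obtain k where k: "\<And>i. \<bar>unit_rat (k i) - coord x i\<bar> \<le> e / 4" by metis
  define n where "n = list_encode (map k [0..<N])"
  \<comment> \<open>Factoring 1/2 as 2/3 times 3/4 bounds the tail beyond \<open>N\<close> by a
    small multiple of a geometric series. One majorant then serves all indices, without splitting
    the series.\<close>
  have "dist (rat_point n) x \<le> (\<Sum>i. (1/2) ^ i * (e / 4) + (2/3) ^ N * (3/4) ^ i)"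
    unfolding dist_hilbert_cube_def
  proof (intro suminf_le summable_hilbert_cube summable_add summable_mult summable_mult2)
    fix i
    show "(1/2) ^ i * \<bar>coord (rat_point n) i - coord x i\<bar> \<le> (1/2) ^ i * (e / 4) + (2/3) ^ N * (3/4) ^ i"
    proof (cases "i < N")
      case True
      then have "(1/2) ^ i * \<bar>coord (rat_point n) i - coord x i\<bar> \<le> (1/2) ^ i * (e / 4)"
        using k[of i] by (intro mult_left_mono) (simp_all add: n_def coord_rat_point)
      then show ?thesis by (simp add: add_increasing2)
    next
      case False
      then have "(2/3::real) ^ i \<le> (2/3) ^ N" by (intro power_decreasing) auto
      then have "(2/3::real) ^ i * (3/4) ^ i \<le> (2/3) ^ N * (3/4) ^ i" by (intro mult_right_mono) auto
      then have "(1/2::real) ^ i \<le> (2/3) ^ N * (3/4) ^ i" by (simp flip: power_mult_distrib)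
      moreover have "(1/2) ^ i * \<bar>coord (rat_point n) i - coord x i\<bar> \<le> (1/2) ^ i"
        using False coord_bounds[of x i] by (simp add: n_def coord_rat_point mult_left_le)
      moreover have "0 \<le> (1/2) ^ i * (e / 4)" using assms by simp
      ultimately show ?thesis by linarith
    qed
  qed (simp_all add: summable_geometric)
  also have "\<dots> = (\<Sum>i. (1/2) ^ i * (e / 4)) + (\<Sum>i. (2/3) ^ N * (3/4) ^ i)"
    by (intro suminf_add[symmetric] summable_mult summable_mult2) (simp_all add: summable_geometric)
  also have "\<dots> = (\<Sum>i. (1/2) ^ i) * (e / 4) + (2/3) ^ N * (\<Sum>i. (3/4) ^ i)"
    by (subst suminf_mult suminf_mult2, simp add: summable_geometric)+ simp
  also have "\<dots> = e / 2 + 4 * (2/3) ^ N"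
    by (simp add: suminf_geometric)
  also have "\<dots> < e" using N by simp
  finally show ?thesis by blast
qed

lemma small_rat_ball:
  assumes "0 < e" shows "\<exists>i. x \<in> rat_ball i \<and> radius i < e"
proof -
  obtain q where "q \<in> \<rat>" "0 < q" "q < e" using Rats_dense_in_real[OF assms] by blast
  then have "q \<in> range pos_rat" unfolding range_pos_rat by simp
  then obtain r where r: "pos_rat r = q" by (metis rangeE)
  obtain n where "dist (rat_point n) x < q" using rat_point_dense[OF \<open>0 < q\<close>] by blast
  with r \<open>q < e\<close> show ?thesis
    by (intro exI[of _ "prod_encode (n, r)"]) (simp add: mem_rat_ball)
qed

text \<open>The triangle inequality costs two radii of \<open>i\<close>: one to pass from
  \<open>x\<close> to its centre, one for the ball itself. Hence a radius below half the gap between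
  \<open>x\<close> and the boundary suffices. The filter form lets finitely many requirements be
  combined.\<close>

lemma eventually_formally_inside:
  assumes "x \<in> rat_ball j"
  shows "\<forall>\<^sub>F e in at_right 0. \<forall>i. x \<in> rat_ball i \<and> radius i < e \<longrightarrow> formally_inside i j"
proof -
  let ?d = "(radius j - dist (centre j) x) / 2"
  have "\<forall>\<^sub>F e in at_right 0. e < ?d"
    using assms by (intro eventually_at_rightI[of 0 ?d]) (auto simp: mem_rat_ball)
  then show ?thesis
  proof eventually_elim
    case (elim e)
    have "formally_inside i j" if "x \<in> rat_ball i" "radius i < e" for i
      using that elim dist_triangle[of "centre i" "centre j" x]
      unfolding formally_inside_def mem_rat_ball by (simp add: dist_commute field_simps)
    then show ?case by blast
  qed
qed

text \<open>The same count of radii as for inclusion; excluding the closed ball makes the gap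
  positive.\<close>

lemma eventually_formally_outside:
  assumes "x \<notin> cball (centre j) (radius j)"
  shows "\<forall>\<^sub>F e in at_right 0. \<forall>i. x \<in> rat_ball i \<and> radius i < e \<longrightarrow> formally_outside i j"
proof -
  let ?d = "(dist (centre j) x - radius j) / 2"
  have "\<forall>\<^sub>F e in at_right 0. e < ?d"
    using assms by (intro eventually_at_rightI[of 0 ?d]) auto
  then show ?thesis
  proof eventually_elim
    case (elim e)
    have "formally_outside i j" if "x \<in> rat_ball i" "radius i < e" for i
      using that elim dist_triangle[of "centre j" x "centre i"]
      unfolding formally_outside_def mem_rat_ball by (simp add: dist_commute field_simps)
    then show ?case by blast
  qed
qed

lemma compact_rat_ball_cover:
  assumes K: "compact K" and R: "\<And>x. x \<in> K \<Longrightarrow> \<exists>i. x \<in> rat_ball i \<and> R i"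
  shows "\<exists>a. K \<subseteq> rat_ball_union a \<and> (\<forall>i\<in>set (list_decode a). R i)"
proof -
  have "\<And>i. i \<in> {i. R i} \<Longrightarrow> open (rat_ball i)"
    by (simp add: rat_ball_def case_prod_beta)
  moreover have "K \<subseteq> (\<Union>i\<in>{i. R i}. rat_ball i)" using R by blast
  ultimately obtain I where I: "I \<subseteq> {i. R i}" "finite I" "K \<subseteq> (\<Union>i\<in>I. rat_ball i)"
    by (rule compactE_image[OF K])
  obtain xs where "set xs = I" using I(2) finite_list by blast
  with I show ?thesis
    by (intro exI[of _ "list_encode xs"]) (auto simp: rat_ball_union_def)
qed

text \<open>Near each point of \<open>K\<close> all sufficiently small balls satisfy the finitely
  many formal requirements, and compactness leaves finitely many balls. Semantic inclusion and
  disjointness thereby acquire decidable certificates.\<close>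

lemma refined_rat_ball_cover:
  assumes K: "compact K" and S: "finite S" "\<And>m. m \<in> S \<Longrightarrow> K \<subseteq> rat_ball_union m"
    and E: "finite E" "\<And>d. d \<in> E \<Longrightarrow> K \<inter> cball (centre d) (radius d) = {}"
  shows "\<exists>a. K \<subseteq> rat_ball_union a \<and> (\<forall>i\<in>set (list_decode a).
    (\<forall>m\<in>S. \<exists>j\<in>set (list_decode m). formally_inside i j) \<and> (\<forall>d\<in>E. formally_outside i d))"
proof (rule compact_rat_ball_cover[OF K])
  fix x assume x: "x \<in> K"
  have "\<forall>\<^sub>F e in at_right 0. \<forall>m\<in>S. \<forall>i. x \<in> rat_ball i \<and> radius i < e \<longrightarrow>
      (\<exists>j\<in>set (list_decode m). formally_inside i j)"
  proof (intro eventually_ball_finite S(1) ballI)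
    fix m assume "m \<in> S"
    then obtain j where j: "j \<in> set (list_decode m)" "x \<in> rat_ball j"
      using S(2) x by (force simp: rat_ball_union_def)
    from eventually_formally_inside[OF j(2)]
    show "\<forall>\<^sub>F e in at_right 0. \<forall>i. x \<in> rat_ball i \<and> radius i < e \<longrightarrow>
      (\<exists>j\<in>set (list_decode m). formally_inside i j)"
      by eventually_elim (use j(1) in blast)
  qed
  moreover have "\<forall>\<^sub>F e in at_right 0. \<forall>d\<in>E. \<forall>i. x \<in> rat_ball i \<and> radius i < e \<longrightarrow>
      formally_outside i d"
    using x E(2) by (intro eventually_ball_finite E(1) ballI eventually_formally_outside) blast
  ultimately have "\<forall>\<^sub>F e::real in at_right 0. \<exists>i. x \<in> rat_ball i \<and>
      (\<forall>m\<in>S. \<exists>j\<in>set (list_decode m). formally_inside i j) \<and> (\<forall>d\<in>E. formally_outside i d)"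
    using eventually_at_right_less[of "0::real"]
  proof eventually_elim
    case (elim e)
    then obtain i where "x \<in> rat_ball i" "radius i < e" using small_rat_ball by blast
    with elim show ?case by blast
  qed
  then show "\<exists>i. x \<in> rat_ball i \<and>
      (\<forall>m\<in>S. \<exists>j\<in>set (list_decode m). formally_inside i j) \<and> (\<forall>d\<in>E. formally_outside i d)"
    using eventually_happens'[OF trivial_limit_at_right_real] by blast
qed

section \<open>A generic enumeration\<close>

instance recf :: countable by countable_datatype

text \<open>A form of Selman's theorem: a set that is c.e. in every enumeration of \<open>V\<close> is enumeration
  reducible to \<open>V\<close>. Otherwise a finite-extension construction yields an enumeration \<open>orc\<close> of \<open>V\<close>
  such that no program semi-decides \<open>T\<close> relative to \<open>orc\<close>. A condition \<open>(s, t)\<close> prescribes the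
  oracle below \<open>t\<close>.\<close>

lemma enumeration_reducible:
  assumes T: "\<forall>orc. pfst ` orc = V \<longrightarrow> ce_rel orc T"
  shows "\<exists>f s0 t0. finite s0 \<and> (\<forall>d. d \<in> T \<longleftrightarrow> (\<exists>s t. finite s \<and> pfst ` s \<subseteq> V \<and>
    t0 \<le> t \<and> (\<forall>x<t0. x \<in> s \<longleftrightarrow> x \<in> s0) \<and> run f s t [d] \<noteq> 0))"
proof (rule ccontr)
  assume contra: "\<not> ?thesis"
  define valid where "valid c \<longleftrightarrow> finite (fst c) \<and> pfst ` fst c \<subseteq> V" for c :: "nat set \<times> nat"
  define ext where "ext c' c \<longleftrightarrow> snd c \<le> snd c' \<and> (\<forall>x<snd c. x \<in> fst c' \<longleftrightarrow> x \<in> fst c)"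
    for c c' :: "nat set \<times> nat"
  have ext_refl: "ext c c" for c by (simp add: ext_def)
  have ext_trans: "ext c'' c" if "ext c'' c'" "ext c' c" for c c' c''
    using that unfolding ext_def by (meson less_le_trans order_trans)
  \<comment> \<open>Either \<open>f\<close> already halts on some \<open>d\<close> outside
    \<open>T\<close>, using only the prescribed part, or on some \<open>d\<close> in
    \<open>T\<close> no valid extension makes it halt. Both kinds of failure survive in every later
    oracle.\<close>
  define defeats where "defeats c f \<longleftrightarrow> (\<exists>d. (d \<notin> T \<and> (\<exists>t\<le>snd c. run f (fst c) t [d] \<noteq> 0)) \<or>
    (d \<in> T \<and> (\<forall>c'. valid c' \<and> ext c' c \<longrightarrow> run f (fst c') (snd c') [d] = 0)))" for c f
  have defeat: "\<exists>c'. valid c' \<and> ext c' c \<and> defeats c' f" if "valid c" for c f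
  proof -
    \<comment> \<open>The negated claim is used with the current condition as \<open>s0\<close> and
      \<open>t0\<close>, so the equivalence fails at some \<open>d\<close>.\<close>
    have not_reducible: "\<not> (\<forall>d. d \<in> T \<longleftrightarrow> (\<exists>s t. finite s \<and> pfst ` s \<subseteq> V \<and> snd c \<le> t \<and>
        (\<forall>x<snd c. x \<in> s \<longleftrightarrow> x \<in> fst c) \<and> run f s t [d] \<noteq> 0))"
      using contra that unfolding valid_def by blast
    have pairs: "(\<exists>s t. finite s \<and> pfst ` s \<subseteq> V \<and> snd c \<le> t \<and>
        (\<forall>x<snd c. x \<in> s \<longleftrightarrow> x \<in> fst c) \<and> run f s t [d] \<noteq> 0) \<longleftrightarrow>
        (\<exists>c'. valid c' \<and> ext c' c \<and> run f (fst c') (snd c') [d] \<noteq> 0)" for d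
      unfolding valid_def ext_def split_paired_Ex by simp
    from not_reducible[unfolded pairs] obtain d where d: "\<not> (d \<in> T \<longleftrightarrow>
        (\<exists>c'. valid c' \<and> ext c' c \<and> run f (fst c') (snd c') [d] \<noteq> 0))"
      unfolding not_all by (rule exE)
    show ?thesis
    proof (cases "d \<in> T")
      case True
      then have "defeats c f" using d unfolding defeats_def by blast
      then show ?thesis using that ext_refl by blast
    next
      case False
      then obtain c' where "valid c'" "ext c' c" "run f (fst c') (snd c') [d] \<noteq> 0" using d by blast
      then show ?thesis using False unfolding defeats_def by blast
    qed
  qed
  have enum: "\<exists>c'. valid c' \<and> ext c' c \<and> (n \<in> V \<longrightarrow> n \<in> pfst ` (fst c' \<inter> {..<snd c'}))"
    if "valid c" for c n
  proof (cases "n \<in> V")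
    case True
    \<comment> \<open>Padding \<open>n\<close> with \<open>snd c\<close> gives an element at or
      above the bound, outside the part already prescribed.\<close>
    let ?m = "prod_encode (n, snd c)"
    have "snd c \<le> ?m" by (rule le_prod_encode_2)
    then have "ext (insert ?m (fst c), Suc ?m) c" unfolding ext_def by auto
    moreover have "valid (insert ?m (fst c), Suc ?m)"
      using that True unfolding valid_def by simp
    moreover have "n \<in> pfst ` (insert ?m (fst c) \<inter> {..<Suc ?m})"
      by (rule image_eqI[of _ _ ?m]) simp_all
    ultimately show ?thesis
      by (intro exI[of _ "(insert ?m (fst c), Suc ?m)"]) simp
  qed (use that ext_refl in blast)
  have both: "\<exists>c'. valid c' \<and> ext c' c \<and> defeats c' (from_nat n) \<and>
      (n \<in> V \<longrightarrow> n \<in> pfst ` (fst c' \<inter> {..<snd c'}))" if "valid c" for c n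
  proof -
    \<comment> \<open>Enumeration precedes the defeat: extensions keep the prescribed part, so the
      entry for \<open>n\<close> survives.\<close>
    obtain c1 where c1: "valid c1" "ext c1 c" "n \<in> V \<longrightarrow> n \<in> pfst ` (fst c1 \<inter> {..<snd c1})"
      using enum[OF \<open>valid c\<close>] by blast
    obtain c2 where c2: "valid c2" "ext c2 c1" "defeats c2 (from_nat n)"
      using defeat[OF c1(1)] by blast
    have "fst c1 \<inter> {..<snd c1} \<subseteq> fst c2 \<inter> {..<snd c2}"
      using c2(2) unfolding ext_def by force
    then show ?thesis using c1 c2 ext_trans by blast
  qed
  have "\<exists>c. \<forall>n. valid (c n) \<and> (ext (c (Suc n)) (c n) \<and> defeats (c (Suc n)) (from_nat n) \<and>
      (n \<in> V \<longrightarrow> n \<in> pfst ` (fst (c (Suc n)) \<inter> {..<snd (c (Suc n))})))"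
  proof (rule dependent_nat_choice)
    show "\<exists>c. valid c" by (rule exI[of _ "({}, 0)"]) (simp add: valid_def)
  qed (rule both)
  then obtain c where valid: "\<And>n. valid (c n)" and step: "\<And>n. ext (c (Suc n)) (c n)"
    and defeats: "\<And>n. defeats (c (Suc n)) (from_nat n)"
    and enumerated: "\<And>n. n \<in> V \<Longrightarrow> n \<in> pfst ` (fst (c (Suc n)) \<inter> {..<snd (c (Suc n))})"
    by blast
  have mono: "ext (c m) (c n)" if "n \<le> m" for m n
    using that by (induction rule: dec_induct) (auto intro: ext_refl ext_trans step)
  \<comment> \<open>Each condition is cut at its bound, since elements beyond it may be dropped by
    later conditions.\<close>
  define orc where "orc = (\<Union>n. fst (c n) \<inter> {..<snd (c n)})"
  have orc: "x \<in> orc \<longleftrightarrow> x \<in> fst (c n)" if "x < snd (c n)" for x n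
  proof -
    have "x \<in> fst (c n)" if "x \<in> fst (c m)" "x < snd (c m)" for m
      using mono[of m n] mono[of n m] that \<open>x < snd (c n)\<close> nat_le_linear[of m n]
      unfolding ext_def by blast
    then show ?thesis using that unfolding orc_def by blast
  qed
  have "pfst ` orc = V"
  proof
    show "pfst ` orc \<subseteq> V" using valid unfolding orc_def valid_def by blast
    show "V \<subseteq> pfst ` orc" using enumerated unfolding orc_def by blast
  qed
  then obtain f where f: "\<And>d. d \<in> T \<longleftrightarrow> (\<exists>y. eval orc f [d] y)"
    using T unfolding ce_rel_def by blast
  define c' where "c' = c (Suc (to_nat f))"
  have orc': "x \<in> orc \<longleftrightarrow> x \<in> fst c'" if "x < snd c'" for x
    using orc that unfolding c'_def by blast
  have "defeats c' f" using defeats[of "to_nat f"] unfolding c'_def by simp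
  then obtain d where "(d \<notin> T \<and> (\<exists>t\<le>snd c'. run f (fst c') t [d] \<noteq> 0)) \<or>
    (d \<in> T \<and> (\<forall>c''. valid c'' \<and> ext c'' c' \<longrightarrow> run f (fst c'') (snd c'') [d] = 0))"
    unfolding defeats_def by blast
  then show False
  proof
    assume "d \<notin> T \<and> (\<exists>t\<le>snd c'. run f (fst c') t [d] \<noteq> 0)"
    then obtain t where t: "d \<notin> T" "t \<le> snd c'" "run f (fst c') t [d] \<noteq> 0" by blast
    have "run f orc t [d] = run f (fst c') t [d]"
      using t(2) by (intro run_cong orc') simp
    then show False using t f eval_iff_run by metis
  next
    assume d: "d \<in> T \<and> (\<forall>c''. valid c'' \<and> ext c'' c' \<longrightarrow> run f (fst c'') (snd c'') [d] = 0)"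
    then obtain y where "eval orc f [d] y" using f by blast
    from eventually_happens'[OF sequentially_bot eventually_conj[OF
        run_complete[OF this] eventually_ge_at_top[of "snd c'"]]]
    obtain t where t: "run f orc t [d] = Suc y" "snd c' \<le> t" by blast
    \<comment> \<open>Cut at \<open>t\<close>, the oracle is a finite valid extension of
      \<open>c'\<close> on which \<open>f\<close> still halts, contrary to the second kind of
      failure.\<close>
    have "run f (orc \<inter> {..<t}) t [d] = Suc y"
      using run_cong[of t "orc \<inter> {..<t}" orc] t(1) by simp
    moreover have "valid (orc \<inter> {..<t}, t)"
      using \<open>pfst ` orc = V\<close> unfolding valid_def by auto
    moreover have "ext (orc \<inter> {..<t}, t) c'"
      using t(2) orc' unfolding ext_def by simp
    ultimately show False using d by force
  qed
qed

section \<open>Minimal pairs\<close>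

lemma ce_rel_meets:
  assumes W: "ce W" and Y: "ce_rel orc {n. Y \<subseteq> rat_ball_union n}"
    and B: "ce_rel orc {n. B \<subseteq> rat_ball_union n}"
    and T: "\<And>d. rat_ball d \<inter> Y \<noteq> {} \<longleftrightarrow> (\<exists>n\<in>W. Y - rat_ball d \<subseteq> rat_ball_union (pfst n)
      \<and> B - rat_ball d \<subseteq> rat_ball_union (psnd n))"
  shows "ce_rel orc {d. rat_ball d \<inter> Y \<noteq> {}}"
proof -
  obtain fW where fW: "\<And>n. n \<in> W \<longleftrightarrow> (\<exists>t. run fW {} t [n] \<noteq> 0)"
    using W ce_rel_run unfolding ce_def by blast
  obtain fY where fY: "\<And>n. Y \<subseteq> rat_ball_union n \<longleftrightarrow> (\<exists>t. run fY orc t [n] \<noteq> 0)"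
    using ce_rel_run[OF Y] by auto
  obtain fB where fB: "\<And>n. B \<subseteq> rat_ball_union n \<longleftrightarrow> (\<exists>t. run fB orc t [n] \<noteq> 0)"
    using ce_rel_run[OF B] by auto
  \<comment> \<open>Adding \<open>d\<close> to the list adds its ball to the union, so covers of the
    remainder are recognised as covers of the whole set.\<close>
  have minus: "K - rat_ball d \<subseteq> rat_ball_union a \<longleftrightarrow> K \<subseteq> rat_ball_union (cons_code d a)" for K d a
    by (auto simp: rat_ball_union_def)
  \<comment> \<open>The witness packs a candidate \<open>n\<close> for \<open>W\<close> with one
    bound for each of three runs. \<open>list_decode 0\<close> is empty; writing the empty oracle
    this way makes the rule for coded finite oracles apply.\<close>
  define P where "P orc d w \<longleftrightarrow> (let n = pfst w; t = pfst (psnd w); u = pfst (psnd (psnd w));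
      v = psnd (psnd (psnd w)) in
      run fW (set (list_decode 0)) t (list_decode (cons_code n 0)) \<noteq> 0 \<and>
      run fY orc u (list_decode (cons_code (cons_code d (pfst n)) 0)) \<noteq> 0 \<and>
      run fB orc v (list_decode (cons_code (cons_code d (psnd n)) 0)) \<noteq> 0)"
    for orc d w
  have "rat_ball d \<inter> Y \<noteq> {} \<longleftrightarrow> (\<exists>w. P orc d w)" for d
  proof -
    have "rat_ball d \<inter> Y \<noteq> {} \<longleftrightarrow> (\<exists>n t u v. run fW {} t [n] \<noteq> 0 \<and>
      run fY orc u [cons_code d (pfst n)] \<noteq> 0 \<and> run fB orc v [cons_code d (psnd n)] \<noteq> 0)"
      unfolding T minus fY fB Bex_def fW by blast
    also have "\<dots> \<longleftrightarrow> (\<exists>n t u v.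
        P orc d (prod_encode (n, prod_encode (t, prod_encode (u, v)))))"
      by (simp add: P_def)
    also have "\<dots> \<longleftrightarrow> (\<exists>w. P orc d w)"
      by (metis prod.collapse prod_decode_inverse)
    finally show ?thesis .
  qed
  moreover have "rec_pred (\<lambda>orc z. P orc (pfst z) (psnd z))"
    unfolding P_def Let_def neq0_conv[symmetric] by (intro rec_intros)
  ultimately show ?thesis using ce_rel_projection[of P orc] by simp
qed

lemma minimal_pair_computable:
  assumes P: "Pi01 P" and min: "minimal_pair P Y B"
    and Y: "semicomputable orc Y" and B: "semicomputable orc B"
  shows "computable orc Y"
proof -
  obtain W where W: "ce W" and PW: "compacts \<times> compacts - P = (\<Union>n\<in>W. upper_basic2 n)"
    using P unfolding Pi01_def by blast
  have pair: "compact Y" "compact B" "B \<subseteq> Y" "(Y, B) \<in> P"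
    and subpair: "\<And>Y' B'. proper_subpair Y' B' Y B \<Longrightarrow> (Y', B') \<notin> P"
    using min unfolding minimal_pair_def pair_in_cube_def by auto
  have "rat_ball d \<inter> Y \<noteq> {} \<longleftrightarrow> (\<exists>n\<in>W. Y - rat_ball d \<subseteq> rat_ball_union (pfst n)
      \<and> B - rat_ball d \<subseteq> rat_ball_union (psnd n))" for d
  proof -
    have "open (rat_ball d)" by (simp add: rat_ball_def split: prod.split)
    then have comp: "compact (Y - rat_ball d)" "compact (B - rat_ball d)"
      using pair by (auto intro: compact_diff)
    \<comment> \<open>If the ball meets \<open>Y\<close>, minimality excludes the smaller pair; if
      not, its removal changes neither \<open>Y\<close> nor \<open>B\<close>, as \<open>B\<close>
      lies in \<open>Y\<close>.\<close>
    have "rat_ball d \<inter> Y \<noteq> {} \<longleftrightarrow> (Y - rat_ball d, B - rat_ball d) \<notin> P"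
    proof
      assume "rat_ball d \<inter> Y \<noteq> {}"
      then have "proper_subpair (Y - rat_ball d) (B - rat_ball d) Y B"
        using comp pair(3) unfolding proper_subpair_def pair_in_cube_def by blast
      then show "(Y - rat_ball d, B - rat_ball d) \<notin> P" by (rule subpair)
    next
      assume *: "(Y - rat_ball d, B - rat_ball d) \<notin> P"
      show "rat_ball d \<inter> Y \<noteq> {}"
      proof
        assume "rat_ball d \<inter> Y = {}"
        then have "Y - rat_ball d = Y" "B - rat_ball d = B" using pair(3) by auto
        with * pair(4) show False by simp
      qed
    qed
    also have "\<dots> \<longleftrightarrow> (Y - rat_ball d, B - rat_ball d) \<in> compacts \<times> compacts - P"
      using comp by (simp add: compacts_def)
    also have "\<dots> \<longleftrightarrow> (\<exists>n\<in>W. Y - rat_ball d \<subseteq> rat_ball_union (pfst n)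
      \<and> B - rat_ball d \<subseteq> rat_ball_union (psnd n))"
      unfolding PW using comp
      by (simp add: upper_basic2_def upper_basic_def compacts_def case_prod_beta)
    finally show ?thesis .
  qed
  from ce_rel_meets[OF W _ _ this] show ?thesis
    using Y B unfolding computable_def semicomputable_def by blast
qed

section \<open>From computability to minimality\<close>

lemma is_copy_pair_in_cube:
  assumes "compact_pair X A" "is_copy X A Y B"
  shows "pair_in_cube Y B"
proof -
  obtain h where h: "homeomorphic_map X (top_of_set Y) h" "h ` A = B"
    using assms(2) unfolding is_copy_def by blast
  have "compact_space (top_of_set Y)"
    using assms(1) h(1) homeomorphic_compact_space homeomorphic_map_imp_homeomorphic_space
    unfolding compact_pair_def by blast
  moreover have "compactin (top_of_set Y) B"
    using assms(1) h homeomorphic_imp_continuous_map image_compactin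
    unfolding compact_pair_def by blast
  ultimately show ?thesis
    unfolding pair_in_cube_def
    by (simp add: compact_space_subtopology compactin_subtopology compact_space_def)
qed

lemma ex_minimal_Pi01:
  assumes pair: "pair_in_cube Y B"
    and comp: "\<And>orc. semicomputable orc Y \<Longrightarrow> semicomputable orc B \<Longrightarrow> computable orc Y"
  shows "\<exists>P. Pi01 P \<and> minimal_pair P Y B"
proof -
  have Y: "compact Y" and B: "compact B" "B \<subseteq> Y" using pair unfolding pair_in_cube_def by auto
  define V where "V = {n. Y \<subseteq> rat_ball_union (pfst n) \<and> B \<subseteq> rat_ball_union (psnd n)}"
  define T where "T = {d. rat_ball d \<inter> Y \<noteq> {}}"
  \<comment> \<open>Codes in \<open>V\<close> describe covers of both sets; \<open>u\<close> fills
    the component that is not being looked up.\<close>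
  obtain u where u: "K \<subseteq> rat_ball_union (u K)" if "compact K" for K
    using compact_rat_ball_cover[of _ "\<lambda>_. True"] small_rat_ball[of 1] zero_less_one by metis
  have ce_T: "\<forall>orc. pfst ` orc = V \<longrightarrow> ce_rel orc T"
  proof (intro allI impI)
    fix orc assume orc: "pfst ` orc = V"
    have "{n. Y \<subseteq> rat_ball_union n} = {n. \<exists>w. w \<in> orc \<and> pfst (pfst w) = n}"
    proof (intro Collect_cong iffI)
      fix n assume "Y \<subseteq> rat_ball_union n"
      then have "prod_encode (n, u B) \<in> pfst ` orc" using u[OF B(1)] unfolding orc V_def by simp
      then obtain w where w: "w \<in> orc" "prod_encode (n, u B) = pfst w" by blast
      then have "pfst (pfst w) = n" by (simp flip: w(2))
      with w(1) show "\<exists>w. w \<in> orc \<and> pfst (pfst w) = n" by blast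
    next
      fix n assume "\<exists>w. w \<in> orc \<and> pfst (pfst w) = n"
      then show "Y \<subseteq> rat_ball_union n" using orc unfolding V_def by blast
    qed
    moreover have "{n. B \<subseteq> rat_ball_union n} = {n. \<exists>w. w \<in> orc \<and> psnd (pfst w) = n}"
    proof (intro Collect_cong iffI)
      fix n assume "B \<subseteq> rat_ball_union n"
      then have "prod_encode (u Y, n) \<in> pfst ` orc" using u[OF Y] unfolding orc V_def by simp
      then obtain w where w: "w \<in> orc" "prod_encode (u Y, n) = pfst w" by blast
      then have "psnd (pfst w) = n" by (simp flip: w(2))
      with w(1) show "\<exists>w. w \<in> orc \<and> psnd (pfst w) = n" by blast
    next
      fix n assume "\<exists>w. w \<in> orc \<and> psnd (pfst w) = n"
      then show "B \<subseteq> rat_ball_union n" using orc unfolding V_def by blast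
    qed
    moreover have "ce_rel orc {n. \<exists>w. w \<in> orc \<and> pfst (pfst w) = n}"
      by (rule ce_rel_projection) (intro rec_intros)
    moreover have "ce_rel orc {n. \<exists>w. w \<in> orc \<and> psnd (pfst w) = n}"
      by (rule ce_rel_projection) (intro rec_intros)
    ultimately have "semicomputable orc Y" "semicomputable orc B"
      unfolding semicomputable_def using Y B by simp_all
    then show "ce_rel orc T" using comp unfolding T_def computable_def by blast
  qed
  from enumeration_reducible[OF ce_T] obtain f s0 t0 where
    reduction: "finite s0 \<and> (\<forall>d. d \<in> T \<longleftrightarrow> (\<exists>s t. finite s \<and> pfst ` s \<subseteq> V \<and>
      t0 \<le> t \<and> (\<forall>x<t0. x \<in> s \<longleftrightarrow> x \<in> s0) \<and> run f s t [d] \<noteq> 0))"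
    by (elim exE) (erule that)
  note T = conjunct2[OF reduction, rule_format]
  obtain c0 where c0: "set (list_decode c0) = s0"
    using conjunct1[OF reduction] finite_list by (metis list_encode_inverse)
  \<comment> \<open>A witness codes a finite oracle \<open>s\<close>, a bound \<open>t\<close> and a
    ball \<open>d\<close>. Formal relations stand in for inclusion and disjointness, so that
    \<open>ok\<close> is decidable and \<open>W\<close> is c.e.\<close>
  define ok where "ok n w \<longleftrightarrow> (let s = pfst w; t = pfst (psnd w); d = psnd (psnd w) in
      t0 \<le> t \<and> (\<forall>x<t0. x \<in> set (list_decode s) \<longleftrightarrow> x \<in> set (list_decode c0)) \<and>
      run f (set (list_decode s)) t (list_decode (cons_code d 0)) \<noteq> 0 \<and>
      (\<forall>i\<in>set (list_decode (pfst n)). formally_outside i d \<and> (\<forall>m\<in>set (list_decode s).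
        \<exists>j\<in>set (list_decode (pfst (pfst m))). formally_inside i j)) \<and>
      (\<forall>i\<in>set (list_decode (psnd n)). \<forall>m\<in>set (list_decode s).
        \<exists>j\<in>set (list_decode (psnd (pfst m))). formally_inside i j))" for n w
  define W where "W = {n. \<exists>w. ok n w}"
  define P where "P = compacts \<times> compacts - (\<Union>n\<in>W. upper_basic2 n)"
  have "rec_pred (\<lambda>orc z. ok (pfst z) (psnd z))"
    unfolding ok_def Let_def neq0_conv[symmetric] by (intro rec_intros)
  then have "ce W"
    unfolding ce_def W_def using ce_rel_projection[of "\<lambda>_. ok"] by simp
  moreover have "(\<Union>n\<in>W. upper_basic2 n) \<subseteq> compacts \<times> compacts"
    by (auto simp: upper_basic2_def upper_basic_def split: prod.splits)
  ultimately have "Pi01 P"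
    unfolding Pi01_def P_def by blast
  have subset: "rat_ball_union a \<subseteq> rat_ball_union b"
    if "\<And>i. i \<in> set (list_decode a) \<Longrightarrow> \<exists>j\<in>set (list_decode b). formally_inside i j" for a b
    using that formally_inside_subset unfolding rat_ball_union_def by blast
  \<comment> \<open>Otherwise the formal inclusions would put the projections of \<open>s\<close>
    into \<open>V\<close>, so the ball \<open>d\<close> would meet \<open>Y\<close>, although the
    given cover of \<open>Y\<close> is disjoint from it.\<close>
  have "(Y, B) \<notin> upper_basic2 n" if "ok n w" for n w
  proof
    assume "(Y, B) \<in> upper_basic2 n"
    then have n: "Y \<subseteq> rat_ball_union (pfst n)" "B \<subseteq> rat_ball_union (psnd n)"
      by (auto simp: upper_basic2_def upper_basic_def case_prod_beta)
    let ?s = "set (list_decode (pfst w))" and ?t = "pfst (psnd w)" and ?d = "psnd (psnd w)"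
    have w: "t0 \<le> ?t" "\<forall>x<t0. x \<in> ?s \<longleftrightarrow> x \<in> s0" "run f ?s ?t [?d] \<noteq> 0"
      and outside: "\<forall>i\<in>set (list_decode (pfst n)). formally_outside i ?d"
      and inside: "\<And>m. m \<in> ?s \<Longrightarrow> rat_ball_union (pfst n) \<subseteq> rat_ball_union (pfst (pfst m))"
        "\<And>m. m \<in> ?s \<Longrightarrow> rat_ball_union (psnd n) \<subseteq> rat_ball_union (psnd (pfst m))"
      using that unfolding ok_def Let_def c0 by (auto intro!: subset)
    have "pfst ` ?s \<subseteq> V"
      using n inside unfolding V_def by blast
    with w have "?d \<in> T" unfolding T by blast
    moreover have "rat_ball ?d \<inter> rat_ball_union (pfst n) = {}"
      using outside formally_outside_disjoint unfolding rat_ball_union_def by blast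
    ultimately show False using n(1) unfolding T_def by blast
  qed
  then have "(Y, B) \<in> P"
    using Y B unfolding P_def W_def compacts_def by blast
  moreover have "(Y', B') \<notin> P" if "proper_subpair Y' B' Y B" for Y' B'
  proof -
    have sub: "compact Y'" "compact B'" "Y' \<subset> Y" "B' \<subseteq> B"
      using that unfolding proper_subpair_def pair_in_cube_def by auto
    obtain y where y: "y \<in> Y" "y \<notin> Y'" using sub(3) by blast
    have "open (- Y')" using sub(1) by (simp add: compact_imp_closed open_Compl)
    then obtain e where e: "0 < e" "ball y e \<subseteq> - Y'" using y(2) openE by blast
    \<comment> \<open>Every point of the closed ball lies within two radii of \<open>y\<close>,
      hence the bound \<open>e / 2\<close>.\<close>
    obtain d where d: "y \<in> rat_ball d" "radius d < e / 2"
      using small_rat_ball[of "e / 2" y] e(1) by auto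
    have "cball (centre d) (radius d) \<subseteq> ball y e"
    proof
      fix x assume "x \<in> cball (centre d) (radius d)"
      then show "x \<in> ball y e"
        using d dist_triangle[of y x "centre d"] by (simp add: mem_rat_ball dist_commute)
    qed
    then have disj: "Y' \<inter> cball (centre d) (radius d) = {}" using e(2) by blast
    have "d \<in> T" using d(1) y(1) unfolding T_def by blast
    then obtain s t where s: "finite s" "pfst ` s \<subseteq> V"
      and t: "t0 \<le> t" "\<forall>x<t0. x \<in> s \<longleftrightarrow> x \<in> s0" "run f s t [d] \<noteq> 0"
      unfolding T by blast
    obtain c where c: "set (list_decode c) = s"
      using s(1) finite_list by (metis list_encode_inverse)
    have V: "Y' \<subseteq> rat_ball_union (pfst (pfst m)) \<and> B' \<subseteq> rat_ball_union (psnd (pfst m))"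
      if "m \<in> s" for m
      using s(2) sub(3,4) that unfolding V_def by blast
    have "\<exists>a. Y' \<subseteq> rat_ball_union a \<and> (\<forall>i\<in>set (list_decode a).
        (\<forall>m\<in>(\<lambda>m. pfst (pfst m)) ` s. \<exists>j\<in>set (list_decode m). formally_inside i j) \<and>
        (\<forall>d\<in>{d}. formally_outside i d))"
      by (rule refined_rat_ball_cover[OF sub(1) finite_imageI[OF s(1)]])
        (use V disj in \<open>blast, simp, blast\<close>)
    then obtain a where a: "Y' \<subseteq> rat_ball_union a"
      "\<forall>i\<in>set (list_decode a). formally_outside i d \<and>
        (\<forall>m\<in>s. \<exists>j\<in>set (list_decode (pfst (pfst m))). formally_inside i j)"
      by auto
    \<comment> \<open>No ball is to be avoided here: disjointness from \<open>d\<close> is demanded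
      of the first component only.\<close>
    have "\<exists>b. B' \<subseteq> rat_ball_union b \<and> (\<forall>i\<in>set (list_decode b).
        (\<forall>m\<in>(\<lambda>m. psnd (pfst m)) ` s. \<exists>j\<in>set (list_decode m). formally_inside i j) \<and>
        (\<forall>d\<in>{}. formally_outside i d))"
      by (rule refined_rat_ball_cover[OF sub(2) finite_imageI[OF s(1)]])
        (use V in \<open>blast, simp, blast\<close>)
    then obtain b where b: "B' \<subseteq> rat_ball_union b"
      "\<forall>i\<in>set (list_decode b). \<forall>m\<in>s. \<exists>j\<in>set (list_decode (psnd (pfst m))). formally_inside i j"
      by auto
    have "ok (prod_encode (a, b)) (prod_encode (c, prod_encode (t, d)))"
      unfolding ok_def Let_def using a b t c c0 by simp
    then have "prod_encode (a, b) \<in> W" unfolding W_def by blast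
    moreover have "(Y', B') \<in> upper_basic2 (prod_encode (a, b))"
      using a b sub by (simp add: upper_basic2_def upper_basic_def compacts_def)
    ultimately show ?thesis unfolding P_def by blast
  qed
  ultimately have "minimal_pair P Y B"
    unfolding minimal_pair_def using pair by blast
  with \<open>Pi01 P\<close> show ?thesis by blast
qed

theorem theorem4p7:
  fixes X :: "'a topology" and A :: "'a set"
  assumes "compact_pair X A"
  shows "strong_computable_type X A \<longleftrightarrow>
    (\<forall>Y B. is_copy X A Y B \<longrightarrow> (\<exists>P. Pi01 P \<and> minimal_pair P Y B))"
proof
  assume "strong_computable_type X A"
  then show "\<forall>Y B. is_copy X A Y B \<longrightarrow> (\<exists>P. Pi01 P \<and> minimal_pair P Y B)"
    unfolding strong_computable_type_def
    using is_copy_pair_in_cube[OF assms] ex_minimal_Pi01 by blast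
next
  assume "\<forall>Y B. is_copy X A Y B \<longrightarrow> (\<exists>P. Pi01 P \<and> minimal_pair P Y B)"
  then show "strong_computable_type X A"
    unfolding strong_computable_type_def using minimal_pair_computable by blast
qed

end
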